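(* Let $\alpha,\gamma,\rho,a\in\mathbb{C}$ with $\operatorname{Re}(\alpha)>0$ and $a\ne0$, and let $\mu$ be a real number, such that $\mu>0$ and $\operatorname{Re}(\rho)>\max\{[\operatorname{Re}(\alpha)]+1,\operatorname{Re}(-\alpha-\gamma)\}$. Then the right-sided Erdélyi–Kober fractional derivative $\mathcal{D}_{\gamma,\alpha}^{-}=\mathcal{D}_{-}^{\alpha,0,\gamma}$ satisfies, for every $x>0$, $$\left(\mathcal{D}_{\gamma,\alpha}^{-}\left(t^{-\rho}I^{m,n}_{p,q}\left[at^{-\mu}\,\middle|\begin{matrix}(a_i,A_i,\alpha_i)_{1,p}\\(b_j,B_j,\beta_j)_{1,q}\end{matrix}\right]\right)\right)(x)=x^{-\rho}\,I^{m,n+1}_{p+1,q+1}\left[ax^{-\mu}\,\middle|\begin{matrix}(1-\alpha-\gamma-\rho,\mu,1),\ (a_i,A_i,\alpha_i)_{1,p}\\(b_j,B_j,\beta_j)_{1,q},\ (1-\gamma-\rho,\mu,1)\end{matrix}\right].$$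
   Context: **$I$-function.** Let $m,n,p,q$ be integers with $0\le m\le q$, $0\le n\le p$; let $a_i\in\mathbb{C}$, $A_i,\alpha_i>0$ $(1\le i\le p)$ and $b_j\in\mathbb{C}$, $B_j,\beta_j>0$ $(1\le j\le q)$. For $z\neq0$ (with a chosen value of $\arg z$; $z^{-s}=e^{-s(\log|z|+i\arg z)}$), $$I^{m,n}_{p,q}\left[z\,\middle|\begin{matrix}(a_i,A_i,\alpha_i)_{1,p}\\(b_j,B_j,\beta_j)_{1,q}\end{matrix}\right]=\frac{1}{2\pi i}\int_{C}\chi(s)z^{-s}\,ds,\qquad \chi(s)=\frac{\prod_{j=1}^{m}\Gamma^{\beta_j}(b_j+B_js)\prod_{i=1}^{n}\Gamma^{\alpha_i}(1-a_i-A_is)}{\prod_{j=m+1}^{q}\Gamma^{\beta_j}(1-b_j-B_js)\prod_{i=n+1}^{p}\Gamma^{\alpha_i}(a_i+A_is)}.$$ Here $(a_i,A_i,\alpha_i)_{1,p}$ is the ordered list of triples for $i=1,\dots,p$ (the first $n$ upper triples and the first $m$ lower triples enter the numerator), $\Gamma^{\kappa}(w)=(\Gamma(w))^{\kappa}$, with the branch of non-integer powers fixed along $C$ and the same for the same triple in all $I$-functions considered; empty products equal $1$. The singularities of $\Gamma^{\beta_j}(b_j+B_js)$, $j\le m$, lie to the left of $C$ and those of $\Gamma^{\alpha_i}(1-a_i-A_is)$, $i\le n$, to the right. **Standing assumptions.** The contour $C$ is the imaginary axis $\operatorname{Re}(s)=0$, traversed upwards, and for each $I$-function occurring the following conditions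 for absolute convergence hold: with (computed from the parameters of that $I$-function) $\mu^*=\sum_{j=1}^q\beta_jB_j-\sum_{i=1}^p\alpha_iA_i$, $\Omega=\sum_{i=1}^p(\frac12-\operatorname{Re}(a_i))\alpha_i-\sum_{j=1}^q(\frac12-\operatorname{Re}(b_j))\beta_j$, $\Delta=\sum_{j=1}^m\beta_jB_j-\sum_{j=m+1}^q\beta_jB_j+\sum_{i=1}^n\alpha_iA_i-\sum_{i=n+1}^p\alpha_iA_i$, either $\Delta>0$ and $|\arg z|<\frac{\pi}{2}\Delta$, or $\Delta\ge0$, $|\arg z|=\frac{\pi}{2}\Delta$ and one of: $\mu^*=0$ and $\Omega<-1$; or $\mu^*\ne0$ and $\Omega+\sigma\mu^*<-1$ where $\sigma=\operatorname{Re}(s)$ on $C$ (so $\sigma=0$). For $t>0$, $\arg(at^{\pm\mu})=\arg a$. **Operators.** For $\operatorname{Re}(\alpha)>0$, $x>0$, the right-sided Saigo fractional integral is $$\left(\mathcal{I}_{-}^{\alpha,\beta,\gamma}f\right)(x)=\frac{1}{\Gamma(\alpha)}\int_x^{\infty}(t-x)^{\alpha-1}t^{-\alpha-\beta}{}_{2}F_1\left(\alpha+\beta,-\gamma;\alpha;1-\tfrac{x}{t}\right)f(t)\,dt,$$ the right-sided Saigo fractional derivative is $$\left(\mathcal{D}_{-}^{\alpha,\beta,\gamma}f\right)(x)=\left(-\frac{d}{dx}\right)^{N}\left(\mathcal{I}_{-}^{-\alpha+N,-\beta-N,\alpha+\gamma}f\right)(x),\qquad N=[\operatorname{Re}(\alpha)]+1,$$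 with $[\cdot]$ the integer part, and $\mathcal{D}_{\gamma,\alpha}^{-}:=\mathcal{D}_{-}^{\alpha,0,\gamma}$. *)

theory Defs
  imports "HOL-Analysis.Analysis"
begin

section \<open>The I-function\<close>

text \<open>A parameter triple \<open>(a, A, \<alpha>)\<close>.\<close>

type_synonym triple = "complex \<times> real \<times> real"

text \<open>
  \<open>G c C \<kappa> s\<close> is the value at \<open>s\<close> of the chosen branch of \<open>\<Gamma>(c + C s)\<close> to the power \<open>\<kappa>\<close> along the
  imaginary axis. Indexing the branches by \<open>c, C, \<kappa>\<close> makes the choice the same for the same triple
  in all I-functions built from \<open>G\<close>. For integer \<open>\<kappa>\<close> (in particular \<open>\<kappa> = 1\<close>) the conditions leave
  only the ordinary power. At a pole of the Gamma function the value is 0, as for the library's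
  \<open>Gamma\<close>, so that the reciprocal power vanishes there.
\<close>

definition gamma_power_branches :: "(complex \<Rightarrow> real \<Rightarrow> real \<Rightarrow> complex \<Rightarrow> complex) \<Rightarrow> bool" where
  "gamma_power_branches G \<longleftrightarrow>
     (\<forall>c C \<kappa>.
        continuous_on {s. Re s = 0 \<and> c + of_real C * s \<notin> \<int>\<^sub>\<le>\<^sub>0} (G c C \<kappa>) \<and>
        (\<forall>s. Re s = 0 \<and> c + of_real C * s \<notin> \<int>\<^sub>\<le>\<^sub>0 \<longrightarrow>
           (\<exists>l. exp l = Gamma (c + of_real C * s) \<and> G c C \<kappa> s = exp (of_real \<kappa> * l))) \<and>
        (\<forall>s. Re s = 0 \<and> c + of_real C * s \<in> \<int>\<^sub>\<le>\<^sub>0 \<longrightarrow> G c C \<kappa> s = 0))"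

text \<open>
  The powers of \<open>\<Gamma>(c + C s)\<close> and of \<open>\<Gamma>(1 - c - C s)\<close> belonging to a triple \<open>(c, C, \<kappa>)\<close>.
\<close>

definition gfac :: "(complex \<Rightarrow> real \<Rightarrow> real \<Rightarrow> complex \<Rightarrow> complex) \<Rightarrow> triple \<Rightarrow> complex \<Rightarrow> complex" where
  "gfac G = (\<lambda>(c, C, \<kappa>) s. G c C \<kappa> s)"

definition gfac_refl :: "(complex \<Rightarrow> real \<Rightarrow> real \<Rightarrow> complex \<Rightarrow> complex) \<Rightarrow> triple \<Rightarrow> complex \<Rightarrow> complex" where
  "gfac_refl G = (\<lambda>(c, C, \<kappa>) s. G (1 - c) (- C) \<kappa> s)"

text \<open>
  \<open>as\<close> and \<open>bs\<close> are the upper and lower parameter lists, so \<open>p = length as\<close> and \<open>q = length bs\<close>.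
\<close>

definition I_chi ::
  "(complex \<Rightarrow> real \<Rightarrow> real \<Rightarrow> complex \<Rightarrow> complex) \<Rightarrow> nat \<Rightarrow> nat \<Rightarrow> triple list \<Rightarrow> triple list \<Rightarrow> complex \<Rightarrow> complex"
where
  "I_chi G m n as bs s =
     ((\<Prod>t\<leftarrow>take m bs. gfac G t s) * (\<Prod>t\<leftarrow>take n as. gfac_refl G t s)) /
     ((\<Prod>t\<leftarrow>drop m bs. gfac_refl G t s) * (\<Prod>t\<leftarrow>drop n as. gfac G t s))"

text \<open>
  \<open>\<theta>\<close> is the chosen value of \<open>arg z\<close>. The contour is \<open>s = \<i> y\<close> with \<open>y\<close> increasing, so \<open>ds = \<i> dy\<close>.
\<close>

definition I_fun ::
  "(complex \<Rightarrow> real \<Rightarrow> real \<Rightarrow> complex \<Rightarrow> complex) \<Rightarrow> nat \<Rightarrow> nat \<Rightarrow> triple list \<Rightarrow> triple list \<Rightarrow>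
   complex \<Rightarrow> real \<Rightarrow> complex"
where
  "I_fun G m n as bs z \<theta> =
     1 / (2 * of_real pi * \<i>) *
     (LINT y|lborel.
        (let s = \<i> * of_real y
         in I_chi G m n as bs s * exp (- s * (of_real (ln (norm z)) + \<i> * of_real \<theta>)) * \<i>))"

definition I_mu :: "triple list \<Rightarrow> triple list \<Rightarrow> real" where
  "I_mu as bs = (\<Sum>(b, B, \<beta>)\<leftarrow>bs. \<beta> * B) - (\<Sum>(a, A, \<alpha>)\<leftarrow>as. \<alpha> * A)"

definition I_Omega :: "triple list \<Rightarrow> triple list \<Rightarrow> real" where
  "I_Omega as bs = (\<Sum>(a, A, \<alpha>)\<leftarrow>as. (1/2 - Re a) * \<alpha>) - (\<Sum>(b, B, \<beta>)\<leftarrow>bs. (1/2 - Re b) * \<beta>)"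

definition I_Delta :: "nat \<Rightarrow> nat \<Rightarrow> triple list \<Rightarrow> triple list \<Rightarrow> real" where
  "I_Delta m n as bs =
     (\<Sum>(b, B, \<beta>)\<leftarrow>take m bs. \<beta> * B) - (\<Sum>(b, B, \<beta>)\<leftarrow>drop m bs. \<beta> * B) +
     (\<Sum>(a, A, \<alpha>)\<leftarrow>take n as. \<alpha> * A) - (\<Sum>(a, A, \<alpha>)\<leftarrow>drop n as. \<alpha> * A)"

text \<open>\<open>\<sigma>\<close> is the real part of \<open>s\<close> on the contour.\<close>

definition I_abs_conv :: "real \<Rightarrow> nat \<Rightarrow> nat \<Rightarrow> triple list \<Rightarrow> triple list \<Rightarrow> real \<Rightarrow> bool" where
  "I_abs_conv \<sigma> m n as bs \<theta> \<longleftrightarrow>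
     (let \<Delta> = I_Delta m n as bs; \<Omega> = I_Omega as bs; \<mu>s = I_mu as bs
      in (\<Delta> > 0 \<and> \<bar>\<theta>\<bar> < pi / 2 * \<Delta>) \<or>
         (\<Delta> \<ge> 0 \<and> \<bar>\<theta>\<bar> = pi / 2 * \<Delta> \<and>
           ((\<mu>s = 0 \<and> \<Omega> < -1) \<or> (\<mu>s \<noteq> 0 \<and> \<Omega> + \<sigma> * \<mu>s < -1))))"

text \<open>
  The standing assumptions on one I-function: orders, positivity, separation of the numerator
  singularities by the imaginary axis, and absolute convergence. The last depends on the argument
  \<open>z\<close> only through \<open>\<theta> = arg z\<close>.
\<close>

definition I_admissible :: "nat \<Rightarrow> nat \<Rightarrow> triple list \<Rightarrow> triple list \<Rightarrow> real \<Rightarrow> bool" where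
  "I_admissible m n as bs \<theta> \<longleftrightarrow>
     m \<le> length bs \<and> n \<le> length as \<and>
     (\<forall>(a, A, \<alpha>)\<in>set as. A > 0 \<and> \<alpha> > 0) \<and>
     (\<forall>(b, B, \<beta>)\<in>set bs. B > 0 \<and> \<beta> > 0) \<and>
     (\<forall>(b, B, \<beta>)\<in>set (take m bs). \<forall>s. b + of_real B * s \<in> \<int>\<^sub>\<le>\<^sub>0 \<longrightarrow> Re s < 0) \<and>
     (\<forall>(a, A, \<alpha>)\<in>set (take n as). \<forall>s. 1 - a - of_real A * s \<in> \<int>\<^sub>\<le>\<^sub>0 \<longrightarrow> Re s > 0) \<and>
     I_abs_conv 0 m n as bs \<theta>"

section \<open>Right-sided Saigo operators\<close>

text \<open>
  The Gauss series suffices for \<open>\<^sub>2F\<^sub>1\<close>, since the operators evaluate it only in the open unit disc.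
\<close>

definition hyp2F1 :: "complex \<Rightarrow> complex \<Rightarrow> complex \<Rightarrow> complex \<Rightarrow> complex" where
  "hyp2F1 a b c z = eval_fps (fps_hypergeo [a, b] [c] 1) z"

definition saigo_integrand ::
  "complex \<Rightarrow> complex \<Rightarrow> complex \<Rightarrow> (real \<Rightarrow> complex) \<Rightarrow> real \<Rightarrow> real \<Rightarrow> complex"
where
  "saigo_integrand \<alpha> \<beta> \<gamma> f x t =
     of_real (t - x) powr (\<alpha> - 1) * of_real t powr (- \<alpha> - \<beta>) *
     hyp2F1 (\<alpha> + \<beta>) (- \<gamma>) \<alpha> (of_real (1 - x / t)) * f t"

definition saigo_int :: "complex \<Rightarrow> complex \<Rightarrow> complex \<Rightarrow> (real \<Rightarrow> complex) \<Rightarrow> real \<Rightarrow> complex" where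
  "saigo_int \<alpha> \<beta> \<gamma> f x = 1 / Gamma \<alpha> * (LINT t:{x<..}|lborel. saigo_integrand \<alpha> \<beta> \<gamma> f x t)"

definition saigo_order :: "complex \<Rightarrow> nat" where
  "saigo_order \<alpha> = nat (\<lfloor>Re \<alpha>\<rfloor> + 1)"

text \<open>The first \<open>k\<close> of the \<open>N\<close> applications of \<open>-d/dx\<close> in the fractional derivative.\<close>

definition saigo_deriv_iter ::
  "nat \<Rightarrow> complex \<Rightarrow> complex \<Rightarrow> complex \<Rightarrow> (real \<Rightarrow> complex) \<Rightarrow> real \<Rightarrow> complex"
where
  "saigo_deriv_iter k \<alpha> \<beta> \<gamma> f =
     (let N = of_nat (saigo_order \<alpha>)
      in ((\<lambda>g x. - vector_derivative g (at x)) ^^ k) (saigo_int (- \<alpha> + N) (- \<beta> - N) (\<alpha> + \<gamma>) f))"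

definition saigo_deriv :: "complex \<Rightarrow> complex \<Rightarrow> complex \<Rightarrow> (real \<Rightarrow> complex) \<Rightarrow> real \<Rightarrow> complex" where
  "saigo_deriv \<alpha> \<beta> \<gamma> f = saigo_deriv_iter (saigo_order \<alpha>) \<alpha> \<beta> \<gamma> f"

text \<open>
  The integral and the derivatives above are total functions with arbitrary values where they do not
  exist; this predicate says that the fractional derivative exists at (and near) \<open>x\<close>.
\<close>

definition saigo_deriv_exists :: "complex \<Rightarrow> complex \<Rightarrow> complex \<Rightarrow> (real \<Rightarrow> complex) \<Rightarrow> real \<Rightarrow> bool" where
  "saigo_deriv_exists \<alpha> \<beta> \<gamma> f x \<longleftrightarrow>
     (let N = of_nat (saigo_order \<alpha>)
      in \<forall>\<^sub>F y in nhds x.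
           set_integrable lborel {y<..} (saigo_integrand (- \<alpha> + N) (- \<beta> - N) (\<alpha> + \<gamma>) f y) \<and>
           (\<forall>k<saigo_order \<alpha>. saigo_deriv_iter k \<alpha> \<beta> \<gamma> f differentiable (at y)))"

definition erdelyi_kober_deriv :: "complex \<Rightarrow> complex \<Rightarrow> (real \<Rightarrow> complex) \<Rightarrow> real \<Rightarrow> complex" where
  "erdelyi_kober_deriv \<gamma> \<alpha> f = saigo_deriv \<alpha> 0 \<gamma> f"

definition erdelyi_kober_deriv_exists :: "complex \<Rightarrow> complex \<Rightarrow> (real \<Rightarrow> complex) \<Rightarrow> real \<Rightarrow> bool" where
  "erdelyi_kober_deriv_exists \<gamma> \<alpha> f x \<longleftrightarrow> saigo_deriv_exists \<alpha> 0 \<gamma> f x"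

end

theory Submission
  imports Defs "HOL-Library.Landau_Symbols"
begin

text \<open>
Along the contour \<open>s = iy\<close> the function \<open>f(x) = x\<^bsup>-\<rho>\<^esup> I[a x\<^bsup>-\<mu>\<^esup>]\<close> is a superposition of the powers \<open>x\<^bsup>-w\<^esup>\<close> with
\<open>w = \<rho> - \<mu>s\<close> and an integrable weight, so it suffices to know the fractional derivative of one power and to
interchange it with the integral over the contour.

For one power, the substitution \<open>t = x/(1-u)\<close> turns the Saigo integral into an Euler integral of
\<open>\<^sub>2F\<^sub>1\<close> against a Beta kernel. Integrating the Gauss series termwise leaves \<open>\<^sub>2F\<^sub>1\<close> at \<open>1\<close>, which Gauss's
theorem (\<open>gauss_summation\<close>) evaluates. The result (\<open>saigo_integral_powr\<close>) is
\<open>x\<^bsup>N-w\<^esup> \<Gamma>(w-N) \<Gamma>(w+\<alpha>+\<gamma>) / (\<Gamma>(w) \<Gamma>(w+\<gamma>))\<close>, normalised by \<open>1/\<Gamma>(N-\<alpha>)\<close>. The two conditions on \<open>Re \<rho>\<close> say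
exactly that the two Gamma functions in the numerator have arguments with positive real part. Applying
\<open>(-d/dx)\<^sup>N\<close> multiplies by \<open>(w-N)(w-N+1)\<cdots>(w-1) = \<Gamma>(w)/\<Gamma>(w-N)\<close>, and what remains,
\<open>\<Gamma>(w+\<alpha>+\<gamma>)/\<Gamma>(w+\<gamma>)\<close>, is the quotient of the two factors that the added triples contribute to \<open>\<chi>\<close>.

The interchange needs integrable weights. Stirling's formula on vertical lines
(\<open>norm_Gamma_vertical_bigtheta\<close>) shows that \<open>\<bar>\<chi>(iy)\<bar>\<close> grows like \<open>\<bar>y\<bar>\<^sup>\<Omega> e\<^bsup>-\<pi>\<Delta>\<bar>y\<bar>/2\<^esup>\<close>, so the convergence
conditions imply integrability (\<open>I_admissible_integrable\<close>) for both I-functions in the statement. The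
condition on the first one is what Fubini's theorem uses for the Saigo integral. The condition on the second
one controls the weight after all \<open>N\<close> derivatives, hence also the weights after fewer derivatives
(\<open>erdelyi_kober_mellin\<close>), and differentiation under the integral sign is a dominated convergence.
\<close>

section \<open>Gauss's summation theorem\<close>

definition gauss_coeff :: "complex \<Rightarrow> complex \<Rightarrow> complex \<Rightarrow> nat \<Rightarrow> complex" where
  "gauss_coeff a b c k = pochhammer a k * pochhammer b k / (pochhammer c k * fact k)"

lemma hyp2F1_eq_suminf: "hyp2F1 a b c z = (\<Sum>k. gauss_coeff a b c k * z ^ k)"
  by (simp add: hyp2F1_def eval_fps_def gauss_coeff_def)

lemma right_half_plane_notin_nonpos_Ints: "Re z > 0 \<Longrightarrow> z \<notin> \<int>\<^sub>\<le>\<^sub>0"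
  by (auto elim!: nonpos_Ints_cases)

text \<open>
Euler's limit \<open>(a)\<^sub>n\<^sub>+\<^sub>1 / (n! n\<^sup>a) \<longlonglongrightarrow> 1/\<Gamma>(a)\<close> gives the growth of Pochhammer symbols, for every
\<open>a\<close> as an upper bound and for positive real \<open>a\<close> also as a lower bound.
\<close>

lemma pochhammer_bigo:
  "(\<lambda>n. norm (pochhammer (a::complex) (Suc n))) \<in> O(\<lambda>n. fact n * real n powr Re a)"
proof -
  have "(\<lambda>n. norm (rGamma_series a n)) \<in> O(\<lambda>_. 1 :: real)"
    by (rule bigoI_tendsto[of _ _ "norm (rGamma a)"])
       (use tendsto_norm[OF rGamma_series_LIMSEQ[of a]] in auto)
  then have "(\<lambda>n. norm (rGamma_series a n) * (fact n * real n powr Re a))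
      \<in> O(\<lambda>n. 1 * (fact n * real n powr Re a))"
    by (intro landau_o.big.mult) auto
  also have "?this \<longleftrightarrow> ?thesis"
    unfolding mult_1
  proof (intro landau_o.big.in_cong eventually_mono[OF eventually_gt_at_top[of 0]])
    fix n :: nat assume "n > 0"
    then show "norm (rGamma_series a n) * (fact n * real n powr Re a)
        = norm (pochhammer a (Suc n))"
      by (simp add: rGamma_series_def norm_divide norm_mult powr_def norm_fact mult.commute)
  qed
  finally show ?thesis .
qed

lemma pochhammer_real_bigtheta:
  assumes "x > 0"
  shows "(\<lambda>n. pochhammer x (Suc n)) \<in> \<Theta>(\<lambda>n. fact n * real n powr x)"
proof -
  have "rGamma_series x \<in> \<Theta>(\<lambda>_. 1 :: real)"
  proof (rule bigthetaI_tendsto[where c = "rGamma x"])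
    show "rGamma x \<noteq> 0" using assms by (auto simp: rGamma_eq_zero_iff elim!: nonpos_Ints_cases)
  qed (use rGamma_series_LIMSEQ[of x] in simp)
  then have "(\<lambda>n. rGamma_series x n * (fact n * real n powr x))
      \<in> \<Theta>(\<lambda>n. 1 * (fact n * real n powr x))"
    by (intro landau_theta.mult) auto
  also have "?this \<longleftrightarrow> ?thesis"
    unfolding mult_1
  proof (intro landau_theta.in_cong eventually_mono[OF eventually_gt_at_top[of 0]])
    fix n :: nat assume "n > 0"
    then show "rGamma_series x n * (fact n * real n powr x) = pochhammer x (Suc n)"
      by (simp add: rGamma_series_def powr_def)
  qed
  finally show ?thesis .
qed

lemma norm_pochhammer_ge:
  assumes "0 \<le> x" "x \<le> Re z"
  shows "pochhammer x k \<le> norm (pochhammer z k)"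
  unfolding pochhammer_prod prod_norm[symmetric]
proof (intro prod_mono conjI)
  fix i
  show "x + real i \<le> norm (z + of_nat i)"
    using complex_Re_le_cmod[of "z + of_nat i"] assms by simp
qed (use assms in auto)

lemma pochhammer_nonzero:
  assumes "Re z > 0"
  shows "pochhammer z k \<noteq> 0"
  using norm_pochhammer_ge[of "Re z" z k] pochhammer_pos[OF assms, of k] assms by auto

lemma gauss_majorant_bigo:
  assumes "x > 0"
  shows "(\<lambda>n. norm (pochhammer a (Suc n) * pochhammer b (Suc n)) / (pochhammer x (Suc n) * fact (Suc n)))
           \<in> O(\<lambda>n. real n powr (Re (a + b) - x - 1))"
proof -
  have "(\<lambda>n. norm (pochhammer a (Suc n)) * norm (pochhammer b (Suc n)) / (pochhammer x (Suc n) * fact (Suc n)))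
     \<in> O(\<lambda>n. (fact n * real n powr Re a) * (fact n * real n powr Re b) /
             ((fact n * real n powr x) * fact (Suc n)))"
    using assms
    by (intro landau_o.big.mult landau_o.big.divide pochhammer_bigo
        bigthetaD1[OF landau_theta.mult] landau_omega.big.mult)
      (use bigthetaD2[OF pochhammer_real_bigtheta[OF assms]] in
        \<open>auto intro!: eventually_mono[OF eventually_gt_at_top[of 0]]
        simp: pochhammer_pos less_imp_neq[symmetric] bigomega_iff_bigo\<close>)
  also have "(\<lambda>n. (fact n * real n powr Re a) * (fact n * real n powr Re b) /
             ((fact n * real n powr x) * fact (Suc n)))
     \<in> O(\<lambda>n. real n powr (Re (a + b) - x - 1))"
  proof (intro bigoI[of _ 1] eventually_mono[OF eventually_gt_at_top[of 0]])
    fix n :: nat assume n: "n > 0"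
    have "(fact n * real n powr Re a) * (fact n * real n powr Re b) /
             ((fact n * real n powr x) * fact (Suc n))
        = real n powr (Re a + Re b - x) / real (Suc n)"
      using n by (simp add: powr_diff powr_add field_simps del: of_nat_Suc)
    also have "\<dots> \<le> real n powr (Re a + Re b - x) / real n"
      using n by (intro divide_left_mono) auto
    also have "\<dots> = real n powr (Re (a + b) - x - 1)"
      using n by (simp add: powr_diff)
    finally show "norm ((fact n * real n powr Re a) * (fact n * real n powr Re b) /
             ((fact n * real n powr x) * fact (Suc n))) \<le> 1 * norm (real n powr (Re (a + b) - x - 1))"
      by simp
  qed
  finally show ?thesis by (simp add: norm_mult)
qed

lemma summable_gauss_majorant:
  assumes "x > 0" "Re (a + b) < x"
  shows "summable (\<lambda>k. norm (pochhammer a k * pochhammer b k) / (pochhammer x k * fact k))"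
proof (subst summable_Suc_iff[symmetric], rule summable_comparison_test_bigo[OF _ gauss_majorant_bigo])
  show "summable (\<lambda>n. norm (real n powr (Re (a + b) - x - 1)))"
    using assms by (simp add: summable_real_powr_iff)
qed fact

text \<open>
Replacing the lower parameter by a smaller positive real number gives a majorant that does not change
when the lower parameter is shifted to the right; this is what makes the limit in the lower
parameter below a dominated one.
\<close>

lemma norm_gauss_coeff_le:
  assumes "0 < x" "x \<le> Re c"
  shows "norm (gauss_coeff a b c k) \<le> norm (pochhammer a k * pochhammer b k) / (pochhammer x k * fact k)"
proof -
  have "pochhammer x k * fact k \<le> norm (pochhammer c k) * fact k" "0 < pochhammer x k"
    using assms by (auto intro!: mult_right_mono norm_pochhammer_ge pochhammer_pos)
  moreover have "0 < norm (pochhammer c k)"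
    using calculation(2) norm_pochhammer_ge[of x c k] assms by linarith
  ultimately show ?thesis
    unfolding gauss_coeff_def norm_divide norm_mult norm_fact
    by (intro divide_left_mono) auto
qed

lemma summable_gauss_coeff:
  assumes "Re c > 0" "Re (a + b) < Re c"
  shows "summable (\<lambda>k. norm (gauss_coeff a b c k))"
  by (rule summable_comparison_test'[OF summable_gauss_majorant[OF assms]])
     (use norm_gauss_coeff_le[OF assms(1) order_refl] in auto)

lemma gauss_coeff_Suc:
  "gauss_coeff a b c (Suc k) * of_nat (Suc k) =
    gauss_coeff a b c k * ((a + of_nat k) * (b + of_nat k) / (c + of_nat k))"
  by (simp add: gauss_coeff_def pochhammer_Suc divide_simps del: of_nat_Suc)

text \<open>
The difference of the two sides telescopes: term by term it is \<open>u\<^sub>k\<^sub>+\<^sub>1 - u\<^sub>k\<close> with \<open>u\<^sub>k = -c k t\<^sub>k\<close>, where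
\<open>t\<^sub>k\<close> is the Gauss coefficient, and \<open>u\<^sub>k \<longlonglongrightarrow> 0\<close> since \<open>t\<^sub>k = O(k\<^bsup>Re (a+b-c) - 1\<^esup>)\<close>.
\<close>

lemma gauss_contiguous:
  assumes c: "Re c > 0" and ab: "Re (a + b) < Re c"
  shows "c * (c - a - b) * (\<Sum>k. gauss_coeff a b c k) =
    (c - a) * (c - b) * (\<Sum>k. gauss_coeff a b (c + 1) k)"
proof -
  define u where "u = (\<lambda>k. - c * (of_nat k * gauss_coeff a b c k))"
  have nz: "c + of_nat k \<noteq> 0" for k
  proof -
    have "Re (c + of_nat k) > 0" using c by simp
    then show ?thesis by (metis less_irrefl zero_complex.sel(1))
  qed
  have step: "c * (c - a - b) * gauss_coeff a b c k - (c - a) * (c - b) * gauss_coeff a b (c + 1) k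
      = u (Suc k) - u k" for k
  proof -
    have shift: "pochhammer (c + 1) k = pochhammer c k * (c + of_nat k) / c"
      using pochhammer_rec[of c k] pochhammer_Suc[of c k] nz[of 0] by (simp add: field_simps)
    have "gauss_coeff a b (c + 1) k = gauss_coeff a b c k * c / (c + of_nat k)"
      unfolding gauss_coeff_def shift using nz[of k] nz[of 0] by (simp add: field_simps)
    moreover have "u (Suc k) = - c * (gauss_coeff a b c k * ((a + of_nat k) * (b + of_nat k) / (c + of_nat k)))"
      unfolding u_def by (subst gauss_coeff_Suc[symmetric]) (simp add: mult_ac)
    moreover have "u k = - c * (of_nat k * gauss_coeff a b c k)"
      by (simp add: u_def)
    moreover have "c * (c - a - b) * g - (c - a) * (c - b) * (g * c / (c + of_nat k))
        = - c * (g * ((a + of_nat k) * (b + of_nat k) / (c + of_nat k))) - - c * (of_nat k * g)" for g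
      using nz[of k] by (simp add: divide_simps) (simp add: algebra_simps)
    ultimately show ?thesis
      by (simp only:)
  qed
  have "(\<lambda>n. norm (u (Suc n))) \<longlonglongrightarrow> 0"
  proof -
    have "(\<lambda>n. norm (u (Suc n))) \<in> O(\<lambda>n. real n powr (Re (a + b) - Re c))"
    proof -
      have "(\<lambda>n. norm (gauss_coeff a b c (Suc n))) \<in> O(\<lambda>n. real n powr (Re (a + b) - Re c - 1))"
      proof (rule landau_o.big.trans[OF landau_o.big_mono gauss_majorant_bigo[OF c]], intro always_eventually allI)
        fix n
        show "norm (norm (gauss_coeff a b c (Suc n))) \<le> norm (norm (pochhammer a (Suc n) * pochhammer b (Suc n)) /
            (pochhammer (Re c) (Suc n) * fact (Suc n)))"
          using norm_gauss_coeff_le[OF c order_refl, of a b "Suc n"]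
          by (simp add: abs_mult abs_of_nonneg[OF pochhammer_nonneg[OF c]])
      qed
      moreover have "(\<lambda>n. norm (- c * of_nat (Suc n))) \<in> O(\<lambda>n. real n)"
        by (intro bigoI[of _ "2 * norm c"] eventually_mono[OF eventually_gt_at_top[of 0]])
           (auto simp: norm_mult mult.commute[of 2] mult.assoc simp del: of_nat_Suc intro!: mult_left_mono)
      ultimately have "(\<lambda>n. norm (- c * of_nat (Suc n)) * norm (gauss_coeff a b c (Suc n)))
          \<in> O(\<lambda>n. real n * real n powr (Re (a + b) - Re c - 1))"
        by (rule landau_o.big.mult[rotated])
      also have "(\<lambda>n. real n * real n powr (Re (a + b) - Re c - 1)) = (\<lambda>n. real n powr (Re (a + b) - Re c))"
      proof
        fix n :: nat
        show "real n * real n powr (Re (a + b) - Re c - 1) = real n powr (Re (a + b) - Re c)"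
          by (cases "n = 0") (auto simp: powr_diff)
      qed
      finally show ?thesis by (simp add: u_def norm_mult mult.assoc)
    qed
    moreover have "(\<lambda>n. real n powr (Re (a + b) - Re c)) \<longlonglongrightarrow> 0"
      using ab by (intro tendsto_neg_powr filterlim_real_sequentially) auto
    then have "(\<lambda>n. real n powr (Re (a + b) - Re c)) \<in> o(\<lambda>_. 1)"
      by (intro smalloI_tendsto) auto
    ultimately have "(\<lambda>n. norm (u (Suc n))) \<in> o(\<lambda>_. 1)"
      by (rule landau_o.big_small_trans)
    then show ?thesis
      by (auto dest: smalloD_tendsto)
  qed
  then have "u \<longlonglongrightarrow> 0"
    by (simp add: filterlim_sequentially_Suc tendsto_norm_zero_iff)
  then have 1: "(\<lambda>k. u (Suc k) - u k) sums (0 - u 0)"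
    by (rule telescope_sums)
  have s1: "summable (gauss_coeff a b c)" "summable (gauss_coeff a b (c + 1))"
    using summable_gauss_coeff[of c a b] summable_gauss_coeff[of "c + 1" a b] c ab
    by (auto intro: summable_norm_cancel)
  have "(\<lambda>k. c * (c - a - b) * gauss_coeff a b c k - (c - a) * (c - b) * gauss_coeff a b (c + 1) k)
     sums (c * (c - a - b) * suminf (gauss_coeff a b c) - (c - a) * (c - b) * suminf (gauss_coeff a b (c + 1)))"
    by (intro sums_diff sums_mult summable_sums s1)
  with 1 show ?thesis
    unfolding step by (auto simp: u_def dest: sums_unique2)
qed

lemma gauss_contiguous_iterate:
  assumes c: "Re c > 0" and ab: "Re (a + b) < Re c"
  shows "pochhammer c n * pochhammer (c - a - b) n * (\<Sum>k. gauss_coeff a b c k) =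
    pochhammer (c - a) n * pochhammer (c - b) n * (\<Sum>k. gauss_coeff a b (c + of_nat n) k)"
proof (induction n)
  case (Suc n)
  have *: "(c + of_nat n) * (c + of_nat n - a - b) * (\<Sum>k. gauss_coeff a b (c + of_nat n) k) =
    (c + of_nat n - a) * (c + of_nat n - b) * (\<Sum>k. gauss_coeff a b (c + of_nat n + 1) k)"
    by (rule gauss_contiguous) (use c ab in auto)
  have "pochhammer c (Suc n) * pochhammer (c - a - b) (Suc n) * (\<Sum>k. gauss_coeff a b c k) =
    (c + of_nat n) * (c - a - b + of_nat n) *
    (pochhammer c n * pochhammer (c - a - b) n * (\<Sum>k. gauss_coeff a b c k))"
    by (simp add: pochhammer_Suc mult_ac)
  also have "\<dots> = pochhammer (c - a) n * pochhammer (c - b) n *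
     ((c + of_nat n) * (c + of_nat n - a - b) * (\<Sum>k. gauss_coeff a b (c + of_nat n) k))"
    unfolding Suc by (simp add: algebra_simps)
  also have "\<dots> = pochhammer (c - a) (Suc n) * pochhammer (c - b) (Suc n) *
     (\<Sum>k. gauss_coeff a b (c + of_nat (Suc n)) k)"
    unfolding * by (simp add: pochhammer_Suc algebra_simps)
  finally show ?case .
qed simp

text \<open>
As the lower parameter grows, each coefficient except the first tends to \<open>0\<close>, and the majorant with lower
parameter \<open>Re c\<close> is summable.
\<close>

lemma gauss_sum_tendsto_1:
  assumes c: "Re c > 0" and ab: "Re (a + b) < Re c"
  shows "(\<lambda>n. \<Sum>k. gauss_coeff a b (c + of_nat n) k) \<longlonglongrightarrow> 1"
proof -
  have lim: "(\<lambda>n. gauss_coeff a b (c + of_nat n) k) \<longlonglongrightarrow> (if k = 0 then 1 else 0)" for k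
  proof (cases k)
    case (Suc j)
    have "(\<lambda>n. pochhammer a k * pochhammer b k / (pochhammer (c + of_nat n) k * fact k)) \<longlonglongrightarrow> 0"
    proof (rule Lim_null_comparison)
      show "\<forall>\<^sub>F n in sequentially. norm (pochhammer a k * pochhammer b k / (pochhammer (c + of_nat n) k * fact k))
         \<le> norm (pochhammer a k * pochhammer b k) / fact j * inverse (real n)"
      proof (intro eventually_mono[OF eventually_gt_at_top[of 0]])
        fix n :: nat assume n: "n > 0"
        \<comment> \<open>One factor of the Pochhammer symbol grows with \<open>n\<close>, the others are at least \<open>1\<close>.\<close>
        have "real n * 1 \<le> real n * pochhammer (real n + 1) j"
        proof (rule mult_left_mono)
          show "1 \<le> pochhammer (real n + 1) j"
            unfolding pochhammer_prod by (rule prod_ge_1) auto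
        qed auto
        also have "\<dots> = pochhammer (real n) k" by (simp add: Suc pochhammer_rec)
        also have "\<dots> \<le> norm (pochhammer (c + of_nat n) k)"
          using c by (intro norm_pochhammer_ge) auto
        finally have *: "real n \<le> norm (pochhammer (c + of_nat n) k)" by simp
        have pos: "0 < norm (pochhammer (c + of_nat n) k)"
          using * n by linarith
        have "real n * fact j \<le> norm (pochhammer (c + of_nat n) k) * fact k"
          using * by (intro mult_mono) (auto simp: Suc intro!: fact_mono)
        then show "norm (pochhammer a k * pochhammer b k / (pochhammer (c + of_nat n) k * fact k))
         \<le> norm (pochhammer a k * pochhammer b k) / fact j * inverse (real n)"
          using n unfolding norm_divide norm_mult[of "pochhammer (c + of_nat n) k"] norm_fact
          by (subst divide_inverse[symmetric], subst divide_divide_eq_left)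
             (intro divide_left_mono, use pos in \<open>auto simp: mult.commute intro!: mult_pos_pos\<close>)
      qed
    qed (intro tendsto_mult_right_zero lim_inverse_n)
    then show ?thesis by (simp add: gauss_coeff_def Suc)
  qed (simp add: gauss_coeff_def)
  have "((\<lambda>n. suminf (\<lambda>k. gauss_coeff a b (c + of_nat n) k)) \<longlonglongrightarrow> (\<Sum>k. if k = 0 then 1 else 0))"
  proof (rule tannerys_theorem[THEN conjunct2, THEN conjunct2, OF lim])
    show "summable (\<lambda>k. norm (pochhammer a k * pochhammer b k) / (pochhammer (Re c) k * fact k))"
      by (rule summable_gauss_majorant) fact+
    show "\<forall>\<^sub>F (k, n) in sequentially \<times>\<^sub>F sequentially. norm (gauss_coeff a b (c + of_nat n) k)
        \<le> norm (pochhammer a k * pochhammer b k) / (pochhammer (Re c) k * fact k)"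
      by (intro always_eventually) (use c in \<open>auto intro!: norm_gauss_coeff_le\<close>)
  qed simp
  then show ?thesis using suminf_finite[of "{0::nat}" "\<lambda>k. if k = 0 then 1 else 0::complex"] by simp
qed

text \<open>
Gauss's summation theorem. Shifting \<open>c\<close> to infinity in the contiguous relation turns the series into
\<open>1\<close>, and the products of linear factors collected on the way are Euler's approximations of
\<open>1/\<Gamma>\<close> at \<open>c\<close>, \<open>c-a-b\<close>, \<open>c-a\<close> and \<open>c-b\<close>, whose powers of \<open>n\<close> cancel.
\<close>

theorem gauss_summation:
  assumes c: "Re c > 0" and ab: "Re (a + b) < Re c"
  shows "(\<Sum>k. gauss_coeff a b c k) = Gamma c * Gamma (c - a - b) * rGamma (c - a) * rGamma (c - b)"
proof -
  define S where "S = (\<Sum>k. gauss_coeff a b c k)"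
  have eq: "rGamma_series c n * rGamma_series (c - a - b) n * S =
      rGamma_series (c - a) n * rGamma_series (c - b) n * (\<Sum>k. gauss_coeff a b (c + of_nat (Suc n)) k)" for n
  proof -
    define L where "L = complex_of_real (ln (of_nat n))"
    have e: "exp (c * L) * exp ((c - a - b) * L) = exp ((c - a) * L) * exp ((c - b) * L)"
      by (simp add: exp_add[symmetric] algebra_simps)
    have "rGamma_series c n * rGamma_series (c - a - b) n * S =
       (pochhammer c (Suc n) * pochhammer (c - a - b) (Suc n) * S) /
       (fact n * fact n * (exp (c * L) * exp ((c - a - b) * L)))"
      by (simp add: rGamma_series_def L_def mult_ac)
    also have "\<dots> = rGamma_series (c - a) n * rGamma_series (c - b) n *
        (\<Sum>k. gauss_coeff a b (c + of_nat (Suc n)) k)"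
      unfolding S_def gauss_contiguous_iterate[OF assms] e
      by (simp add: rGamma_series_def L_def mult_ac)
    finally show ?thesis .
  qed
  have "(\<lambda>n. rGamma_series (c - a) n * rGamma_series (c - b) n * (\<Sum>k. gauss_coeff a b (c + of_nat (Suc n)) k))
     \<longlonglongrightarrow> rGamma (c - a) * rGamma (c - b) * 1"
    by (intro tendsto_intros filterlim_compose[OF gauss_sum_tendsto_1[OF assms] filterlim_Suc])
  moreover have "(\<lambda>n. rGamma_series c n * rGamma_series (c - a - b) n * S)
     \<longlonglongrightarrow> rGamma c * rGamma (c - a - b) * S"
    by (intro tendsto_intros)
  ultimately have main: "rGamma c * rGamma (c - a - b) * S = rGamma (c - a) * rGamma (c - b)"
    unfolding eq by (auto dest: LIMSEQ_unique)
  have "rGamma c \<noteq> 0" "rGamma (c - a - b) \<noteq> 0"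
    using c ab right_half_plane_notin_nonpos_Ints[of c] right_half_plane_notin_nonpos_Ints[of "c - a - b"]
    by (auto simp: rGamma_eq_zero_iff)
  with main show ?thesis
    by (simp add: S_def Gamma_def field_simps)
qed

section \<open>Beta integrals with complex exponents\<close>

lemma set_integrable_continuous_bound:
  fixes f :: "real \<Rightarrow> complex"
  assumes "S \<in> sets borel" "continuous_on S f" "set_integrable lborel S g"
    and "\<And>x. x \<in> S \<Longrightarrow> norm (f x) \<le> g x"
  shows "set_integrable lborel S f"
proof (rule set_integrable_bound[OF assms(3)])
  show "set_borel_measurable lborel S f"
    using borel_measurable_continuous_on_indicator[OF assms(1,2)]
    by (simp add: set_borel_measurable_def)
qed (use assms(4) in \<open>auto intro!: AE_I2 intro: order_trans[OF _ abs_ge_self]\<close>)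

lemma set_integral_power_series_termwise:
  fixes g :: "real \<Rightarrow> complex" and w :: "nat \<Rightarrow> complex"
  assumes S: "S \<in> sets lborel" "S \<subseteq> {0<..<1}"
    and int: "\<And>k. set_integrable lborel S (\<lambda>u. of_real u ^ k * g u)"
    and conv: "\<And>u. u \<in> S \<Longrightarrow> summable (\<lambda>k. norm (w k * of_real u ^ k))"
    and summ: "summable (\<lambda>k. norm (w k) * (LINT u:S|lborel. u ^ k * norm (g u)))"
  shows "set_integrable lborel S (\<lambda>u. (\<Sum>k. w k * of_real u ^ k) * g u)" (is ?A)
    and "(LINT u:S|lborel. (\<Sum>k. w k * of_real u ^ k) * g u) = (\<Sum>k. w k * (LINT u:S|lborel. of_real u ^ k * g u))" (is ?B)
proof -
  define F where "F = (\<lambda>k u. indicator S u *\<^sub>R (w k * (of_real u ^ k * g u)))"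
  have nF: "norm (F k u) = norm (w k) * (indicator S u *\<^sub>R (u ^ k * norm (g u)))" for k u
    using S(2) by (auto simp: F_def norm_mult norm_power indicator_def)
  have 1: "integrable lborel (F k)" for k
    using int[of k] unfolding F_def set_integrable_def[symmetric] by simp
  have 2: "summable (\<lambda>k. norm (F k u))" for u
  proof (cases "u \<in> S")
    case True
    from summable_mult2[OF conv[OF True], of "norm (g u)"] show ?thesis
      using True by (simp add: F_def norm_mult mult.assoc)
  qed (simp add: F_def)
  have 3: "summable (\<lambda>k. LINT u|lborel. norm (F k u))"
    using summ unfolding nF set_lebesgue_integral_def by simp
  have sumF: "(\<Sum>k. F k u) = indicator S u *\<^sub>R ((\<Sum>k. w k * of_real u ^ k) * g u)" for u
  proof (cases "u \<in> S")
    case True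
    then show ?thesis
      using summable_norm_cancel[OF conv[OF True]]
      by (simp add: F_def suminf_mult2 mult.assoc)
  qed (simp add: F_def)
  have "integrable lborel (\<lambda>u. \<Sum>k. F k u)"
    by (rule integrable_suminf[OF 1 AE_I2 3]) (rule 2)
  then show ?A unfolding sumF set_integrable_def .
  have "(LINT u|lborel. (\<Sum>k. F k u)) = (\<Sum>k. (LINT u|lborel. F k u))"
    by (rule integral_suminf[OF 1 AE_I2 3]) (rule 2)
  moreover have "(LINT u|lborel. F k u) = w k * (LINT u:S|lborel. of_real u ^ k * g u)" for k
    unfolding F_def set_lebesgue_integral_def by (simp flip: integral_mult_right_zero add: mult.left_commute scaleR_conv_of_real)
  ultimately show ?B unfolding sumF set_lebesgue_integral_def by simp
qed

definition beta_kernel :: "complex \<Rightarrow> complex \<Rightarrow> real \<Rightarrow> complex" where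
  "beta_kernel p q u = of_real u powr (p - 1) * of_real (1 - u) powr (q - 1)"

lemma norm_beta_kernel:
  assumes "u \<in> {0<..<1}"
  shows "norm (beta_kernel p q u) = u powr (Re p - 1) * (1 - u) powr (Re q - 1)"
  unfolding beta_kernel_def norm_mult using assms by (subst (1 2) norm_powr_real_powr) auto

lemma continuous_on_of_real_powr:
  fixes f :: "real \<Rightarrow> real"
  assumes "continuous_on S f" "\<And>x. x \<in> S \<Longrightarrow> f x > 0"
  shows "continuous_on S (\<lambda>x. complex_of_real (f x) powr z)"
proof -
  have "continuous_on S (\<lambda>x. exp (z * of_real (ln (f x))))"
    using assms by (intro continuous_intros) (auto simp: less_imp_neq[symmetric])
  then show ?thesis
    by (rule continuous_on_eq) (use assms(2) in \<open>force simp: powr_def Ln_of_real\<close>)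
qed

lemma continuous_on_beta_kernel: "continuous_on {0<..<1} (beta_kernel p q)"
  unfolding beta_kernel_def by (intro continuous_on_mult continuous_on_of_real_powr) (auto intro!: continuous_intros)

lemma real_beta_integral:
  assumes "a > 0" "b > (0::real)"
  shows "set_integrable lborel {0<..<1} (\<lambda>u. u powr (a - 1) * (1 - u) powr (b - 1))"
    and "(LINT u:{0<..<1}|lborel. u powr (a - 1) * (1 - u) powr (b - 1)) = Beta a b"
proof -
  show 1: "set_integrable lborel {0<..<1} (\<lambda>u. u powr (a - 1) * (1 - u) powr (b - 1))"
    by (rule set_integrable_subset[OF integrable_Beta[OF assms]]) auto
  show "(LINT u:{0<..<1}|lborel. u powr (a - 1) * (1 - u) powr (b - 1)) = Beta a b"
    using has_integral_Beta_real[OF assms] set_borel_integral_eq_integral(2)[OF 1]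
    unfolding has_integral_Icc_iff_Ioo by (simp add: has_integral_iff)
qed

lemma set_integrable_beta_kernel:
  assumes "Re p > 0" "Re q > 0"
  shows "set_integrable lborel {0<..<1} (beta_kernel p q)"
  by (rule set_integrable_continuous_bound[OF _ continuous_on_beta_kernel real_beta_integral(1)[OF assms]])
     (auto simp: norm_beta_kernel)

lemma integral_norm_beta_kernel:
  assumes "Re p > 0" "Re q > 0"
  shows "(LINT u:{0<..<1}|lborel. norm (beta_kernel p q u)) = Beta (Re p) (Re q)"
  by (subst real_beta_integral(2)[OF assms, symmetric], rule set_lebesgue_integral_cong)
     (auto simp: norm_beta_kernel)

lemma power_mult_beta_kernel:
  assumes "u \<in> {0<..<1}"
  shows "of_real u ^ k * beta_kernel p q u = beta_kernel (p + of_nat k) q u"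
proof -
  have "of_real u powr (p + of_nat k - 1) = of_real u powr (p - 1) * (of_real u powr of_nat k :: complex)"
    by (simp flip: powr_add add: algebra_simps)
  then show ?thesis using assms by (simp add: beta_kernel_def powr_nat' mult_ac)
qed

lemma Beta_add_nat:
  assumes "a > 0" "b > (0::real)"
  shows "Beta (a + real k) b = Beta a b * pochhammer a k / pochhammer (a + b) k"
proof -
  have "Gamma (x + real k) = Gamma x * pochhammer x k" if "x > 0" for x :: real
    using pochhammer_rGamma[of x k] that
    by (simp add: Gamma_def rGamma_eq_zero_iff pochhammer_eq_0_iff field_simps)
  from this[of a] this[of "a + b"] show ?thesis
    using assms by (simp add: Beta_def add_ac)
qed

text \<open>
Multiplying the kernel by \<open>u\<^sup>k\<close> shifts \<open>p\<close> by \<open>k\<close>, so the \<open>L\<^sup>1\<close> norms of the terms are real Beta values,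
proportional to \<open>(Re p)\<^sub>k / (Re p + Re q)\<^sub>k\<close>. Their summability justifies termwise integration.
\<close>

lemma beta_kernel_power_series:
  fixes w :: "nat \<Rightarrow> complex"
  assumes p: "Re p > 0" and q: "Re q > 0"
    and conv: "\<And>u. u \<in> {0<..<1} \<Longrightarrow> summable (\<lambda>k. norm (w k * of_real u ^ k))"
    and summ: "summable (\<lambda>k. norm (w k) * (pochhammer (Re p) k / pochhammer (Re p + Re q) k))"
  shows "set_integrable lborel {0<..<1} (\<lambda>u. (\<Sum>k. w k * of_real u ^ k) * beta_kernel p q u)"
    and "(LINT u:{0<..<1}|lborel. (\<Sum>k. w k * of_real u ^ k) * beta_kernel p q u) =
      (\<Sum>k. w k * (LINT u:{0<..<1}|lborel. beta_kernel (p + of_nat k) q u))"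
proof -
  have int: "set_integrable lborel {0<..<1} (\<lambda>u. of_real u ^ k * beta_kernel p q u)" for k
    using set_integrable_beta_kernel[of "p + of_nat k" q] p q
    by (subst set_integrable_cong[OF refl refl power_mult_beta_kernel]) (auto simp: add_pos_nonneg)
  have m: "(LINT u:{0<..<1}|lborel. of_real u ^ k * beta_kernel p q u) =
      (LINT u:{0<..<1}|lborel. beta_kernel (p + of_nat k) q u)" for k
    by (rule set_lebesgue_integral_cong) (auto simp: power_mult_beta_kernel)
  have "(LINT u:{0<..<1}|lborel. u ^ k * norm (beta_kernel p q u)) =
      Beta (Re p) (Re q) * (pochhammer (Re p) k / pochhammer (Re p + Re q) k)" for k
  proof -
    have "(LINT u:{0<..<1}|lborel. u ^ k * norm (beta_kernel p q u)) =
        (LINT u:{0<..<1}|lborel. norm (beta_kernel (p + of_nat k) q u))"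
      by (rule set_lebesgue_integral_cong)
         (auto simp: power_mult_beta_kernel[symmetric] norm_mult norm_power)
    also have "\<dots> = Beta (Re p + real k) (Re q)"
      using p q by (subst integral_norm_beta_kernel) (auto simp: add_pos_nonneg)
    finally show ?thesis using Beta_add_nat[OF p q] by simp
  qed
  with summable_mult[OF summ, of "Beta (Re p) (Re q)"]
  have "summable (\<lambda>k. norm (w k) * (LINT u:{0<..<1}|lborel. u ^ k * norm (beta_kernel p q u)))"
    by (simp add: mult_ac)
  note * = set_integral_power_series_termwise[OF _ order_refl int conv this]
  show "set_integrable lborel {0<..<1} (\<lambda>u. (\<Sum>k. w k * of_real u ^ k) * beta_kernel p q u)"
    by (rule *) auto
  show "(LINT u:{0<..<1}|lborel. (\<Sum>k. w k * of_real u ^ k) * beta_kernel p q u) =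
      (\<Sum>k. w k * (LINT u:{0<..<1}|lborel. beta_kernel (p + of_nat k) q u))"
    unfolding m[symmetric] by (rule *) auto
qed

lemma summable_gauss_coeff_power:
  assumes "Re c > 0" "norm z < 1"
  shows "summable (\<lambda>k. norm (gauss_coeff a b c k * z ^ k))"
proof -
  have quot: "(\<lambda>k. (x + of_nat k) / (y + of_nat k)) \<longlonglongrightarrow> 1" if "Re y > 0" for x y :: complex
  proof -
    have "(\<lambda>k. 1 + (x - y) / (y + of_nat k)) \<longlonglongrightarrow> 1 + 0"
      by (intro tendsto_intros tendsto_divide_0[OF tendsto_const]
          tendsto_add_filterlim_at_infinity[OF tendsto_const] tendsto_of_nat)
    also have "(\<lambda>k. 1 + (x - y) / (y + of_nat k)) = (\<lambda>k. (x + of_nat k) / (y + of_nat k))"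
    proof
      fix k
      have "y + of_nat k \<noteq> 0" using that by (auto simp: complex_eq_iff)
      then show "1 + (x - y) / (y + of_nat k) = (x + of_nat k) / (y + of_nat k)"
        by (simp add: field_simps)
    qed
    finally show ?thesis by simp
  qed
  have "(\<lambda>k. norm ((a + of_nat k) / (c + of_nat k) * ((b + of_nat k) / (1 + of_nat k)) * z)) \<longlonglongrightarrow> norm (1 * 1 * z)"
    by (intro tendsto_intros quot assms) auto
  then have "\<forall>\<^sub>F k in sequentially.
      norm ((a + of_nat k) / (c + of_nat k) * ((b + of_nat k) / (1 + of_nat k)) * z) < (1 + norm z) / 2"
    using assms(2) by (intro order_tendstoD(2)) auto
  then obtain N where N: "\<And>k. k \<ge> N \<Longrightarrow>
      norm ((a + of_nat k) / (c + of_nat k) * ((b + of_nat k) / (1 + of_nat k)) * z) < (1 + norm z) / 2"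
    by (auto simp: eventually_sequentially)
  show ?thesis
  proof (rule summable_ratio_test[where c = "(1 + norm z) / 2" and N = N])
    fix k assume "k \<ge> N"
    have "gauss_coeff a b c (Suc k) = gauss_coeff a b c k * ((a + of_nat k) / (c + of_nat k) * ((b + of_nat k) / (1 + of_nat k)))"
      by (simp add: gauss_coeff_def pochhammer_Suc mult_ac)
    then have "norm (gauss_coeff a b c (Suc k) * z ^ Suc k) =
       norm ((a + of_nat k) / (c + of_nat k) * ((b + of_nat k) / (1 + of_nat k)) * z) * norm (gauss_coeff a b c k * z ^ k)"
      by (simp add: norm_mult norm_divide norm_power)
    also have "\<dots> \<le> (1 + norm z) / 2 * norm (gauss_coeff a b c k * z ^ k)"
      using N[OF \<open>k \<ge> N\<close>] by (intro mult_right_mono) auto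
    finally show "norm (norm (gauss_coeff a b c (Suc k) * z ^ Suc k))
       \<le> (1 + norm z) / 2 * norm (norm (gauss_coeff a b c k * z ^ k))"
      by simp
  qed (use assms in auto)
qed

lemma beta_kernel_one_integral:
  assumes "Re p > 0"
  shows "(LINT u:{0<..<1}|lborel. beta_kernel p 1 u) = 1 / p"
proof -
  have p0: "p \<noteq> 0" using assms by auto
  have "(LBINT u=0..1. beta_kernel p 1 u) = 1 powr p / p - 0"
  proof (rule interval_integral_FTC_integrable[where F = "\<lambda>u. of_real u powr p / p"])
    fix u :: real assume "0 < ereal u" "ereal u < 1"
    then have u: "0 < u" "u < 1" by (auto simp: zero_ereal_def one_ereal_def)
    have "((\<lambda>z. z powr p / p) has_field_derivative of_real u powr (p - 1)) (at (of_real u))"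
      using u p0 by (auto intro!: derivative_eq_intros simp: complex_nonpos_Reals_iff)
    then have "((\<lambda>u. of_real u powr p / p) has_vector_derivative of_real u powr (p - 1)) (at u)"
      by (rule has_vector_derivative_real_field)
    then show "((\<lambda>u. of_real u powr p / p) has_vector_derivative beta_kernel p 1 u) (at u)"
      using u by (simp add: beta_kernel_def)
    show "isCont (beta_kernel p 1) u"
      using continuous_on_beta_kernel[of p 1] u by (simp add: continuous_on_eq_continuous_at)
  next
    show "set_integrable lborel (einterval 0 1) (beta_kernel p 1)"
      using set_integrable_beta_kernel[of p 1] assms by (simp add: zero_ereal_def one_ereal_def einterval_eq)
    have "((\<lambda>u. of_real u powr p / p) \<longlongrightarrow> 0) (at_right (0::real))"
    proof (rule Lim_null_comparison)
      show "\<forall>\<^sub>F u in at_right 0. norm (of_real u powr p / p) \<le> u powr Re p / norm p"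
        by (auto simp: eventually_at_filter norm_divide norm_powr_real_powr)
      have "((\<lambda>u. u powr Re p / norm p) \<longlongrightarrow> 0 powr Re p / norm p) (at_right 0)"
        using assms p0 by (intro tendsto_intros tendsto_powr') (auto simp: eventually_at_filter)
      then show "((\<lambda>u. u powr Re p / norm p) \<longlongrightarrow> 0) (at_right 0)" by simp
    qed
    then show "(((\<lambda>u. of_real u powr p / p) \<circ> real_of_ereal) \<longlongrightarrow> 0) (at_right 0)"
      unfolding zero_ereal_def by (simp add: ereal_tendsto_simps1)
    have "((\<lambda>u. of_real u powr p / p) \<longlongrightarrow> of_real 1 powr p / p) (at_left (1::real))"
      using p0 by (intro tendsto_intros) auto
    then show "(((\<lambda>u. of_real u powr p / p) \<circ> real_of_ereal) \<longlongrightarrow> 1 powr p / p) (at_left 1)"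
      unfolding one_ereal_def by (simp add: ereal_tendsto_simps1)
  qed simp
  then show ?thesis
    by (simp add: interval_lebesgue_integral_def zero_ereal_def one_ereal_def einterval_eq)
qed

text \<open>
Expanding \<open>(1-u)\<^bsup>q-1\<^esup>\<close> by the binomial series reduces the Beta integral with complex exponents to
integrals of powers; the resulting series is \<open>\<^sub>2F\<^sub>1(1-q, p; p+1; 1)/p\<close>, which Gauss's theorem evaluates.
\<close>

theorem complex_beta_integral:
  assumes p: "Re p > 0" and q: "Re q > 0"
  shows "(LINT u:{0<..<1}|lborel. beta_kernel p q u) = Gamma p * Gamma q * rGamma (p + q)"
proof -
  define w where "w = gauss_coeff (1 - q) 1 1"
  have conv: "summable (\<lambda>k. norm (w k * of_real u ^ k))" if "u \<in> {0<..<1}" for u :: real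
    unfolding w_def using that by (intro summable_gauss_coeff_power) auto
  have series: "(\<Sum>k. w k * of_real u ^ k) * beta_kernel p 1 u = beta_kernel p q u" if "u \<in> {0<..<1}" for u :: real
  proof -
    have "(\<lambda>k. ((q - 1) gchoose k) * (- of_real u) ^ k) sums (1 + - of_real u) powr (q - 1)"
      using that by (intro gen_binomial_complex) auto
    also have "(\<lambda>k. ((q - 1) gchoose k) * (- of_real u) ^ k) = (\<lambda>k. w k * of_real u ^ k)"
    proof
      fix k
      have "(- 1) ^ k * (- 1) ^ k = (1::complex)" by (simp flip: power_mult_distrib)
      then show "((q - 1) gchoose k) * (- of_real u) ^ k = w k * of_real u ^ k"
        by (simp add: w_def gauss_coeff_def gbinomial_pochhammer power_minus[of "of_real u"] pochhammer_fact[symmetric] mult_ac)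
    qed
    finally show ?thesis using that by (simp add: beta_kernel_def sums_iff mult_ac)
  qed
  have coeff: "w k * (1 / (p + of_nat k)) = gauss_coeff (1 - q) p (p + 1) k / p" for k
  proof -
    have "p + of_nat k \<noteq> 0"
    proof -
      have "Re (p + of_nat k) > 0" using p by simp
      then show ?thesis by (metis less_irrefl zero_complex.sel(1))
    qed
    moreover have "p \<noteq> 0" using p by auto
    moreover have "pochhammer (p + 1) k \<noteq> 0"
      using p by (intro pochhammer_nonzero) auto
    ultimately have "pochhammer p k = p * pochhammer (p + 1) k / (p + of_nat k)"
      using pochhammer_rec[of p k] pochhammer_Suc[of p k] by (simp add: field_simps)
    then show ?thesis
      using \<open>p \<noteq> 0\<close> \<open>pochhammer (p + 1) k \<noteq> 0\<close>
      by (simp add: w_def gauss_coeff_def pochhammer_fact[symmetric] mult_ac)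
  qed
  have summ: "summable (\<lambda>k. norm (w k) * (pochhammer (Re p) k / pochhammer (Re p + Re 1) k))"
  proof -
    have "norm (w k) * (pochhammer (Re p) k / pochhammer (Re p + Re 1) k) =
       norm (pochhammer (1 - q) k * pochhammer (of_real (Re p)) k) / (pochhammer (Re p + 1) k * fact k)" for k
      by (simp add: w_def gauss_coeff_def pochhammer_fact[symmetric] norm_divide norm_mult norm_fact
          pochhammer_of_real abs_of_nonneg pochhammer_nonneg p)
    moreover have "summable (\<lambda>k. norm (pochhammer (1 - q) k * pochhammer (of_real (Re p)) k) / (pochhammer (Re p + 1) k * fact k))"
      using p q by (intro summable_gauss_majorant) auto
    ultimately show ?thesis by simp
  qed
  have "(LINT u:{0<..<1}|lborel. beta_kernel p q u) =
     (LINT u:{0<..<1}|lborel. (\<Sum>k. w k * of_real u ^ k) * beta_kernel p 1 u)"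
    by (rule set_lebesgue_integral_cong) (auto simp: series)
  also have "\<dots> = (\<Sum>k. w k * (LINT u:{0<..<1}|lborel. beta_kernel (p + of_nat k) 1 u))"
    by (rule beta_kernel_power_series(2)[OF p _ conv summ]) auto
  also have "\<dots> = (\<Sum>k. gauss_coeff (1 - q) p (p + 1) k / p)"
  proof -
    have "(LINT u:{0<..<1}|lborel. beta_kernel (p + of_nat k) 1 u) = 1 / (p + of_nat k)" for k
      using p by (intro beta_kernel_one_integral) (simp add: add_pos_nonneg)
    then show ?thesis by (simp only: coeff)
  qed
  also have "\<dots> = (\<Sum>k. gauss_coeff (1 - q) p (p + 1) k) / p"
    using p q by (intro suminf_divide summable_norm_cancel[OF summable_gauss_coeff]) auto
  also have "\<dots> = Gamma (p + 1) * Gamma q * rGamma (p + q) / p"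
    using p q by (subst gauss_summation) (auto simp: add_ac)
  also have "\<dots> = Gamma p * Gamma q * rGamma (p + q)"
  proof -
    have "p \<notin> \<int>\<^sub>\<le>\<^sub>0" "p \<noteq> 0" using p right_half_plane_notin_nonpos_Ints[OF p] by auto
    then show ?thesis by (simp add: Gamma_plus1)
  qed
  finally show ?thesis .
qed

text \<open>
Integrating the Gauss series term by term against the Beta kernel replaces the lower parameter \<open>c\<close>
by \<open>c+q\<close> and evaluates the series at \<open>1\<close>, so Gauss's theorem applies a second time.
\<close>

theorem hyp2F1_beta_integral:
  assumes c: "Re c > 0" and q: "Re q > 0" and ab: "Re (a + b) < Re (c + q)"
  shows "set_integrable lborel {0<..<1} (\<lambda>u. hyp2F1 a b c (of_real u) * beta_kernel c q u)"
    and "(LINT u:{0<..<1}|lborel. hyp2F1 a b c (of_real u) * beta_kernel c q u) =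
      Gamma c * Gamma q * Gamma (c + q - a - b) * rGamma (c + q - a) * rGamma (c + q - b)"
proof -
  have conv: "summable (\<lambda>k. norm (gauss_coeff a b c k * of_real u ^ k))" if "u \<in> {0<..<1}" for u :: real
    using that c by (intro summable_gauss_coeff_power) auto
  have cq: "Re (c + q) > 0" using c q by simp
  have summ: "summable (\<lambda>k. norm (gauss_coeff a b c k) * (pochhammer (Re c) k / pochhammer (Re c + Re q) k))"
  proof (rule summable_comparison_test'[OF summable_gauss_majorant[OF cq ab]])
    fix k :: nat
    have pos: "pochhammer (Re c) k > 0" "pochhammer (Re c + Re q) k > 0"
      using c q by (auto intro!: pochhammer_pos)
    have "norm (gauss_coeff a b c k) * (pochhammer (Re c) k / pochhammer (Re c + Re q) k)
       \<le> norm (pochhammer a k * pochhammer b k) / (pochhammer (Re c) k * fact k) * (pochhammer (Re c) k / pochhammer (Re c + Re q) k)"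
      using pos by (intro mult_right_mono norm_gauss_coeff_le c) auto
    also have "\<dots> = norm (pochhammer a k * pochhammer b k) / (pochhammer (Re (c + q)) k * fact k)"
      using pos by (simp add: field_simps)
    finally show "norm (norm (gauss_coeff a b c k) * (pochhammer (Re c) k / pochhammer (Re c + Re q) k))
       \<le> norm (pochhammer a k * pochhammer b k) / (pochhammer (Re (c + q)) k * fact k)"
      using pos by simp
  qed
  note * = beta_kernel_power_series[OF c q conv summ, folded hyp2F1_eq_suminf]
  show "set_integrable lborel {0<..<1} (\<lambda>u. hyp2F1 a b c (of_real u) * beta_kernel c q u)"
    by (rule *)
  note nz = right_half_plane_notin_nonpos_Ints
  have coeff: "gauss_coeff a b c k * (LINT u:{0<..<1}|lborel. beta_kernel (c + of_nat k) q u) =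
      Gamma c * Gamma q * rGamma (c + q) * gauss_coeff a b (c + q) k" for k
  proof -
    have "(LINT u:{0<..<1}|lborel. beta_kernel (c + of_nat k) q u) =
        Gamma (c + of_nat k) * Gamma q * rGamma (c + q + of_nat k)"
      using c q by (subst complex_beta_integral) (auto simp: add_ac add_pos_nonneg)
    moreover have "Gamma (c + of_nat k) = pochhammer c k * Gamma c"
      using pochhammer_Gamma[OF nz[OF c], of k] Gamma_eq_zero_iff[of c] nz[OF c] by simp
    moreover have "rGamma (c + q + of_nat k) = rGamma (c + q) / pochhammer (c + q) k"
      using pochhammer_rGamma[of "c + q" k] cq by (auto simp: field_simps rGamma_eq_zero_iff nz)
    moreover have "pochhammer c k \<noteq> 0"
      using c by (intro pochhammer_nonzero) auto
    ultimately show ?thesis by (simp add: gauss_coeff_def mult_ac)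
  qed
  have "(LINT u:{0<..<1}|lborel. hyp2F1 a b c (of_real u) * beta_kernel c q u) =
      (\<Sum>k. Gamma c * Gamma q * rGamma (c + q) * gauss_coeff a b (c + q) k)"
    by (subst *(2)) (assumption, simp only: coeff)
  also have "\<dots> = Gamma c * Gamma q * rGamma (c + q) * (\<Sum>k. gauss_coeff a b (c + q) k)"
    using summable_norm_cancel[OF summable_gauss_coeff[OF cq ab]] by (rule suminf_mult)
  also have "\<dots> = Gamma c * Gamma q * Gamma (c + q - a - b) * rGamma (c + q - a) * rGamma (c + q - b)"
    using nz[OF cq] by (simp add: gauss_summation[OF cq ab] rGamma_inverse_Gamma Gamma_eq_zero_iff)
  finally show "(LINT u:{0<..<1}|lborel. hyp2F1 a b c (of_real u) * beta_kernel c q u) =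
      Gamma c * Gamma q * Gamma (c + q - a - b) * rGamma (c + q - a) * rGamma (c + q - b)" .
qed

section \<open>Stirling's formula on vertical lines\<close>

text \<open>
The comparison functions of Stirling's formula on vertical lines. They are closed under products and
quotients, the two exponents being additive.
\<close>

abbreviation stirling_growth :: "real \<Rightarrow> real \<Rightarrow> real \<Rightarrow> real" where
  "stirling_growth r d \<equiv> (\<lambda>y. \<bar>y\<bar> powr r * exp (- (pi / 2 * d * \<bar>y\<bar>)))"

lemma bigtheta_divide_filter:
  fixes f1 f2 g1 g2 :: "'a \<Rightarrow> real"
  assumes "f1 \<in> \<Theta>[F](f2)" "g1 \<in> \<Theta>[F](g2)"
  shows "(\<lambda>x. f1 x / g1 x) \<in> \<Theta>[F](\<lambda>x. f2 x / g2 x)"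
  using assms unfolding divide_inverse by (intro landau_theta.mult) (simp_all add: bigtheta_inverse)

lemma eventually_at_infinity_abs_ge: "\<forall>\<^sub>F y in at_infinity. \<bar>y::real\<bar> \<ge> b"
  unfolding eventually_at_infinity by (intro exI[of _ b]) auto

text \<open>
On the line \<open>Re z = 1/2\<close> the reflection \<open>z \<mapsto> 1 - z\<close> is complex conjugation, so the reflection formula
computes \<open>\<bar>\<Gamma>(z)\<bar>\<^sup>2\<close>.
\<close>

lemma norm_Gamma_half:
  "norm (Gamma (Complex (1/2) y)) ^ 2 = pi / cosh (pi * y)"
proof -
  define z where "z = Complex (1/2) y"
  have "1 - z = cnj z" by (simp add: z_def complex_eq_iff)
  then have "Gamma z * cnj (Gamma z) = of_real pi / sin (of_real pi * z)"
    using Gamma_reflection_complex[of z] by (simp add: cnj_Gamma)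
  moreover have "sin (of_real pi * z) = of_real (cosh (pi * y))"
  proof -
    have "of_real pi * z = of_real pi / 2 + \<i> * of_real (pi * y)"
      by (simp add: z_def complex_eq_iff)
    then have "sin (of_real pi * z) = cos (\<i> * of_real (pi * y))"
      by (simp add: sin_add)
    also have "\<dots> = of_real (cosh (pi * y))"
      by (simp only: cosh_conv_cos[symmetric]) (simp add: cosh_def scaleR_conv_of_real flip: exp_of_real)
    finally show ?thesis .
  qed
  ultimately have "of_real (norm (Gamma z) ^ 2) = complex_of_real (pi / cosh (pi * y))"
    by (simp only: complex_norm_square of_real_divide)
  then show ?thesis unfolding z_def of_real_eq_iff .
qed

lemma norm_Gamma_half_bigtheta:
  "(\<lambda>y. norm (Gamma (Complex (1/2) y))) \<in> \<Theta>[at_infinity](stirling_growth 0 1)"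
proof -
  have "(\<lambda>y. norm (Gamma (Complex (1/2) y)) ^ 2) \<in> \<Theta>[at_infinity](\<lambda>y. exp (- (pi * \<bar>y\<bar>)))"
    unfolding norm_Gamma_half
  proof (rule bigthetaI'[of pi "2 * pi"], simp, simp, intro always_eventually allI)
    fix y :: real
    define t where "t = pi * \<bar>y\<bar>"
    have ct: "cosh (pi * y) = cosh t" by (cases "y \<ge> 0") (simp_all add: t_def)
    moreover have "cosh t \<le> exp t" "exp t \<le> 2 * cosh t"
    proof -
      have "exp (-t) \<le> exp t" by (simp add: t_def)
      then show "cosh t \<le> exp t" "exp t \<le> 2 * cosh t" by (simp_all add: cosh_def)
    qed
    moreover have "cosh t > 0" by (rule cosh_real_pos)
    ultimately have "exp (- t) \<le> 1 / cosh (pi * y) \<and> 1 / cosh (pi * y) \<le> 2 * exp (- t)"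
      unfolding ct by (simp add: exp_minus divide_simps)
    then have "pi * exp (- t) \<le> pi * (1 / cosh (pi * y)) \<and> pi * (1 / cosh (pi * y)) \<le> pi * (2 * exp (- t))"
      by (simp only: mult_le_cancel_left_pos[OF pi_gt_zero] simp_thms)
    then show "pi * norm (exp (- (pi * \<bar>y\<bar>))) \<le> norm (pi / cosh (pi * y)) \<and>
        norm (pi / cosh (pi * y)) \<le> 2 * pi * norm (exp (- (pi * \<bar>y\<bar>)))"
      by (simp add: t_def cosh_real_pos abs_of_pos mult_ac)
  qed
  from bigtheta_powr[OF this, of "1/2"]
  have "(\<lambda>y. norm (Gamma (Complex (1/2) y))) \<in> \<Theta>[at_infinity](\<lambda>y. exp (- (pi / 2 * \<bar>y\<bar>)))"
    by (simp add: powr_half_sqrt exp_powr_real)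
  also have "(\<lambda>y. exp (- (pi / 2 * \<bar>y\<bar>))) \<in> \<Theta>[at_infinity](stirling_growth 0 1)"
    by (intro bigthetaI_cong eventually_mono[OF eventually_at_infinity_abs_ge[of 1]]) auto
  finally show ?thesis .
qed

text \<open>
The trigamma function is the second derivative of \<open>ln \<Gamma>\<close>. A bound that is uniform in \<open>\<bar>y\<bar> \<ge> 1\<close> makes
\<open>t \<mapsto> ln \<bar>\<Gamma>(t + iy)\<bar>\<close> affine on unit intervals, up to an error independent of \<open>y\<close>.
\<close>

lemma trigamma_bounded:
  "\<exists>K. \<forall>t\<ge>0. \<forall>y. \<bar>y\<bar> \<ge> 1 \<longrightarrow> norm (Polygamma 1 (Complex t y)) \<le> K"
proof (intro exI allI impI)
  fix t y :: real assume ty: "t \<ge> 0" "\<bar>y\<bar> \<ge> 1"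
  have summ: "summable (\<lambda>k. 1 / (1 + real k ^ 2))"
  proof (rule summable_comparison_test'[where N = 1])
    show "summable (\<lambda>k. inverse (real k ^ 2))"
      using inverse_power_summable[of 2, where 'a = real] by simp
    show "norm (1 / (1 + real k ^ 2)) \<le> inverse (real k ^ 2)" if "k \<ge> 1" for k
      using that by (simp add: divide_inverse abs_of_nonneg add_nonneg_nonneg le_imp_inverse_le)
  qed
  have le: "norm (inverse ((Complex t y + of_nat k) ^ 2)) \<le> 1 / (1 + real k ^ 2)" for k
  proof -
    have "1 + real k ^ 2 \<le> y ^ 2 + (t + real k) ^ 2"
      using ty power_mono[of "real k" "t + real k" 2] one_le_power[of "\<bar>y\<bar>" 2]
      by (intro add_mono) auto
    also have "\<dots> = norm (Complex t y + of_nat k) ^ 2"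
      by (simp add: cmod_power2)
    finally show ?thesis
      by (simp add: norm_inverse norm_power divide_inverse add_pos_nonneg le_imp_inverse_le)
  qed
  have "norm (\<Sum>k. inverse ((Complex t y + of_nat k) ^ 2)) \<le> (\<Sum>k. 1 / (1 + real k ^ 2))"
    by (rule norm_suminf_le[OF le summ])
  then show "norm (Polygamma 1 (Complex t y)) \<le> (\<Sum>k. 1 / (1 + real k ^ 2))"
    by (simp add: Polygamma_def numeral_2_eq_2)
qed

lemma Complex_notin_nonpos_Reals: "y \<noteq> 0 \<Longrightarrow> Complex t y \<notin> \<real>\<^sub>\<le>\<^sub>0"
  by (simp add: complex_nonpos_Reals_iff)

lemma Complex_notin_nonpos_Ints: "y \<noteq> 0 \<Longrightarrow> Complex t y \<notin> \<int>\<^sub>\<le>\<^sub>0"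
  by (auto elim!: nonpos_Ints_cases simp: complex_eq_iff)

lemma DERIV_Re_Complex:
  assumes "(f has_field_derivative f') (at (Complex t y))"
  shows "((\<lambda>t. Re (f (Complex t y))) has_real_derivative Re f') (at t)"
proof -
  have *: "(\<lambda>t. Complex t y) = (\<lambda>t. of_real t + \<i> * of_real y)"
    by (simp add: fun_eq_iff complex_eq_iff)
  have "((\<lambda>t. Complex t y) has_vector_derivative 1) (at t)"
    unfolding * by (auto intro!: derivative_eq_intros)
  from field_vector_diff_chain_at[OF this assms]
  have "((\<lambda>t. f (Complex t y)) has_vector_derivative f') (at t)" by (simp add: o_def)
  from bounded_linear.has_vector_derivative[OF bounded_linear_Re this]
  show ?thesis by (simp add: has_real_derivative_iff_has_vector_derivative)
qed

lemma norm_Gamma_Complex: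
  assumes "y \<noteq> 0"
  shows "norm (Gamma (Complex t y)) = exp (Re (ln_Gamma (Complex t y)))"
  using rGamma_complex_altdef[of "Complex t y"] Complex_notin_nonpos_Ints[OF assms]
  by (simp add: Gamma_def norm_inverse exp_minus)

lemma norm_Complex_bigtheta: "(\<lambda>y. norm (Complex t y)) \<in> \<Theta>[at_infinity](\<lambda>y. \<bar>y\<bar>)"
proof (rule bigthetaI'[of 1 2])
  show "\<forall>\<^sub>F y in at_infinity. 1 * norm \<bar>y\<bar> \<le> norm (norm (Complex t y)) \<and> norm (norm (Complex t y)) \<le> 2 * norm \<bar>y\<bar>"
  proof (rule eventually_mono[OF eventually_at_infinity_abs_ge[of "\<bar>t\<bar>"]])
    fix y assume "\<bar>t\<bar> \<le> \<bar>y\<bar>"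
    then show "1 * norm \<bar>y\<bar> \<le> norm (norm (Complex t y)) \<and> norm (norm (Complex t y)) \<le> 2 * norm \<bar>y\<bar>"
      using abs_Im_le_cmod[of "Complex t y"] cmod_le[of "Complex t y"] by simp
  qed
qed auto

text \<open>
With \<open>h(t) = ln \<bar>\<Gamma>(t + iy)\<bar>\<close>, the mean value theorem and the bound on \<open>h''\<close> give
\<open>h(t + \<delta>) - h(t) = \<delta> (h(t + 1) - h(t)) + O(1)\<close>, and the functional equation says that
\<open>h(t + 1) - h(t) = ln \<bar>t + iy\<bar>\<close>. This interpolates the functional equation to fractional shifts.
\<close>

lemma norm_Gamma_shift_bigtheta:
  assumes "0 \<le> t" "0 \<le> \<delta>" "\<delta> \<le> 1"
  shows "(\<lambda>y. norm (Gamma (Complex (t + \<delta>) y))) \<in>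
    \<Theta>[at_infinity](\<lambda>y. norm (Gamma (Complex t y)) * norm (Complex t y) powr \<delta>)"
proof (cases "\<delta> = 0")
  case True
  show ?thesis
    unfolding True
    by (intro bigthetaI_cong eventually_mono[OF eventually_at_infinity_abs_ge[of 1]]) (auto simp: complex_eq_iff)
next
  case False
  with assms have \<delta>: "0 < \<delta>" "\<delta> \<le> 1" by auto
  obtain K where K: "\<And>t y. t \<ge> 0 \<Longrightarrow> \<bar>y\<bar> \<ge> 1 \<Longrightarrow> norm (Polygamma 1 (Complex t y)) \<le> K"
    using trigamma_bounded by blast
  have main: "exp (- K) * (norm (Gamma (Complex t y)) * norm (Complex t y) powr \<delta>) \<le> norm (Gamma (Complex (t + \<delta>) y)) \<and>
     norm (Gamma (Complex (t + \<delta>) y)) \<le> exp K * (norm (Gamma (Complex t y)) * norm (Complex t y) powr \<delta>)"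
    if y: "\<bar>y\<bar> \<ge> 1" for y
  proof -
    have y0: "y \<noteq> 0" using y by auto
    define h where "h = (\<lambda>t. Re (ln_Gamma (Complex t y)))"
    define d where "d = (\<lambda>t. Re (Digamma (Complex t y)))"
    have h: "(h has_real_derivative d x) (at x)" for x
      unfolding h_def d_def
      by (intro DERIV_Re_Complex has_field_derivative_ln_Gamma_complex Complex_notin_nonpos_Reals y0)
    have d: "(d has_real_derivative Re (Polygamma 1 (Complex x y))) (at x)" for x
      unfolding d_def
      using DERIV_Re_Complex[OF has_field_derivative_Polygamma[of "Complex x y" 0 UNIV]] Complex_notin_nonpos_Ints[OF y0]
      by simp
    have dle: "\<bar>d v - d u\<bar> \<le> K" if uv: "t \<le> u" "u < v" "v \<le> t + 1" for u v
    proof -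
      from MVT2[OF uv(2) d] obtain x where x: "u < x" "x < v" "d v - d u = (v - u) * Re (Polygamma 1 (Complex x y))"
        by blast
      have "\<bar>Re (Polygamma 1 (Complex x y))\<bar> \<le> K"
        using K[of x y] y x uv assms abs_Re_le_cmod[of "Polygamma 1 (Complex x y)"] by simp
      then have "(v - u) * \<bar>Re (Polygamma 1 (Complex x y))\<bar> \<le> 1 * K"
        using uv by (intro mult_mono) auto
      then show ?thesis using x uv by (simp add: abs_mult)
    qed
    from MVT2[of t "t + \<delta>" h d] h \<delta> obtain u where u: "t < u" "u < t + \<delta>" "h (t + \<delta>) - h t = \<delta> * d u"
      by auto
    from MVT2[of t "t + 1" h d] h obtain v where v: "t < v" "v < t + 1" "h (t + 1) - h t = d v"
      by auto
    have "\<bar>d u - d v\<bar> \<le> K"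
    proof (cases u v rule: linorder_cases)
      case equal
      have "K \<ge> 0" using order_trans[OF norm_ge_zero K[of 0 1]] by simp
      then show ?thesis using equal by simp
    qed (use dle[of u v] dle[of v u] u v \<delta> in auto)
    then have "\<delta> * \<bar>d u - d v\<bar> \<le> 1 * K" using \<delta> by (intro mult_mono) auto
    then have est: "\<bar>h (t + \<delta>) - h t - \<delta> * (h (t + 1) - h t)\<bar> \<le> K"
      using \<delta> unfolding u(3) v(3) by (simp add: abs_mult flip: right_diff_distrib)
    have nz: "norm (Complex t y) > 0" using y0 by (simp add: complex_eq_iff)
    have "Gamma (Complex (t + 1) y) = Complex t y * Gamma (Complex t y)"
      using Gamma_plus1[OF Complex_notin_nonpos_Ints[OF y0, of t]] by (simp add: complex_eq_iff plus_complex.ctr one_complex.ctr)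
    then have "exp (h (t + 1)) = norm (Complex t y) * exp (h t)"
      by (simp add: h_def norm_mult flip: norm_Gamma_Complex[OF y0])
    then have "ln (exp (h (t + 1))) = ln (norm (Complex t y)) + h t"
      using nz by (simp add: ln_mult)
    then have diff: "h (t + 1) - h t = ln (norm (Complex t y))" by simp
    have "norm (Gamma (Complex t y)) * norm (Complex t y) powr \<delta> = exp (h t + \<delta> * (h (t + 1) - h t))"
      using nz norm_Gamma_Complex[OF y0] unfolding diff by (simp add: h_def powr_def exp_add)
    moreover have "norm (Gamma (Complex (t + \<delta>) y)) = exp (h (t + \<delta>))"
      using norm_Gamma_Complex[OF y0] by (simp add: h_def)
    ultimately show ?thesis
      using est by (simp add: exp_add[symmetric] abs_le_iff)
  qed
  show ?thesis
    by (rule bigthetaI'[of "exp (- K)" "exp K"])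
       (use main in \<open>auto intro!: eventually_mono[OF eventually_at_infinity_abs_ge[of 1]]\<close>)
qed

lemma norm_Gamma_Complex_bigtheta_step:
  "(\<lambda>y. norm (Gamma (Complex (t + 1) y))) \<in> \<Theta>[at_infinity](\<lambda>y. norm (Gamma (Complex t y)) * \<bar>y\<bar>)"
proof -
  have "(\<lambda>y. norm (Gamma (Complex (t + 1) y))) \<in> \<Theta>[at_infinity](\<lambda>y. norm (Gamma (Complex t y)) * norm (Complex t y))"
  proof (intro bigthetaI_cong eventually_mono[OF eventually_at_infinity_abs_ge[of 1]])
    fix y :: real assume "\<bar>y\<bar> \<ge> 1"
    then have y0: "y \<noteq> 0" by auto
    have "Gamma (Complex (t + 1) y) = Complex t y * Gamma (Complex t y)"
      using Gamma_plus1[OF Complex_notin_nonpos_Ints[OF y0, of t]] by (simp add: complex_eq_iff plus_complex.ctr one_complex.ctr)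
    then show "norm (Gamma (Complex (t + 1) y)) = norm (Gamma (Complex t y)) * norm (Complex t y)"
      by (simp add: norm_mult)
  qed
  also have "(\<lambda>y. norm (Gamma (Complex t y)) * norm (Complex t y)) \<in> \<Theta>[at_infinity](\<lambda>y. norm (Gamma (Complex t y)) * \<bar>y\<bar>)"
    by (intro landau_theta.mult norm_Complex_bigtheta) auto
  finally show ?thesis .
qed

text \<open>
Stirling's formula on vertical lines, up to constants. From the line \<open>Re z = 1/2\<close> a fractional shift
\<open>\<delta> \<in> [0,1]\<close> and an integer shift, up or down by the functional equation, reach every other line.
\<close>

theorem norm_Gamma_Complex_bigtheta:
  "(\<lambda>y. norm (Gamma (Complex t y))) \<in> \<Theta>[at_infinity](stirling_growth (t - 1/2) 1)"
proof -
  define P where "P = (\<lambda>t. (\<lambda>y. norm (Gamma (Complex t y))) \<in> \<Theta>[at_infinity](stirling_growth (t - 1/2) 1))"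
  define k where "k = \<lfloor>t - 1/2\<rfloor>"
  define \<delta> where "\<delta> = t - 1/2 - of_int k"
  have \<delta>: "0 \<le> \<delta>" "\<delta> \<le> 1" unfolding \<delta>_def k_def by linarith+
  have base: "P (1/2 + \<delta>)"
  proof -
    have "(\<lambda>y. norm (Gamma (Complex (1/2) y)) * norm (Complex (1/2) y) powr \<delta>)
        \<in> \<Theta>[at_infinity](\<lambda>y. stirling_growth 0 1 y * \<bar>y\<bar> powr \<delta>)"
      using bigtheta_powr[OF norm_Complex_bigtheta[of "1/2"], of \<delta>]
      by (intro landau_theta.mult norm_Gamma_half_bigtheta) simp
    also have "(\<lambda>y. stirling_growth 0 1 y * \<bar>y\<bar> powr \<delta>) \<in> \<Theta>[at_infinity](stirling_growth \<delta> 1)"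
      by (intro bigthetaI_cong eventually_mono[OF eventually_at_infinity_abs_ge[of 1]]) auto
    finally show ?thesis
      unfolding P_def
      using landau_theta.trans[OF norm_Gamma_shift_bigtheta[of "1/2" \<delta>]] \<delta> by simp
  qed
  have growth: "(\<lambda>y. stirling_growth (t - 1/2) 1 y * \<bar>y\<bar>) \<in> \<Theta>[at_infinity](stirling_growth (t + 1 - 1/2) 1)" for t
  proof (intro bigthetaI_cong eventually_mono[OF eventually_at_infinity_abs_ge[of 1]])
    fix y :: real assume y: "1 \<le> \<bar>y\<bar>"
    have "\<bar>y\<bar> powr (t + 1 - 1/2) = \<bar>y\<bar> powr (t - 1/2 + 1)" by (simp add: algebra_simps)
    also have "\<dots> = \<bar>y\<bar> powr (t - 1/2) * \<bar>y\<bar>" using y by (subst powr_add) auto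
    finally show "stirling_growth (t - 1/2) 1 y * \<bar>y\<bar> = stirling_growth (t + 1 - 1/2) 1 y" by simp
  qed
  have up: "P (t + 1)" if "P t" for t
  proof -
    have "(\<lambda>y. norm (Gamma (Complex t y)) * \<bar>y\<bar>) \<in> \<Theta>[at_infinity](\<lambda>y. stirling_growth (t - 1/2) 1 y * \<bar>y\<bar>)"
      using that unfolding P_def by (intro landau_theta.mult) auto
    from landau_theta.trans[OF norm_Gamma_Complex_bigtheta_step landau_theta.trans[OF this growth]]
    show ?thesis unfolding P_def .
  qed
  have down: "P t" if "P (t + 1)" for t
  proof -
    have "(\<lambda>y. norm (Gamma (Complex t y)) * \<bar>y\<bar>) \<in> \<Theta>[at_infinity](\<lambda>y. norm (Gamma (Complex (t + 1) y)))"
      using norm_Gamma_Complex_bigtheta_step[of t] by (simp add: bigtheta_sym)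
    also have "(\<lambda>y. norm (Gamma (Complex (t + 1) y))) \<in> \<Theta>[at_infinity](stirling_growth (t + 1 - 1/2) 1)"
      using that unfolding P_def .
    also have "stirling_growth (t + 1 - 1/2) 1 \<in> \<Theta>[at_infinity](\<lambda>y. stirling_growth (t - 1/2) 1 y * \<bar>y\<bar>)"
      using growth[of t] by (simp add: bigtheta_sym)
    finally have *: "(\<lambda>y. norm (Gamma (Complex t y)) * \<bar>y\<bar>) \<in> \<Theta>[at_infinity](\<lambda>y. stirling_growth (t - 1/2) 1 y * \<bar>y\<bar>)" .
    have "(\<lambda>y. norm (Gamma (Complex t y)) * \<bar>y\<bar> / \<bar>y\<bar>) \<in> \<Theta>[at_infinity](\<lambda>y. stirling_growth (t - 1/2) 1 y * \<bar>y\<bar> / \<bar>y\<bar>)"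
      by (rule bigtheta_divide_filter[OF *]) simp
    also have "?this \<longleftrightarrow> P t"
      unfolding P_def
      by (intro landau_theta.cong_ex eventually_mono[OF eventually_at_infinity_abs_ge[of 1]]) auto
    finally show ?thesis .
  qed
  have "P (1/2 + \<delta> + of_int k)"
  proof (induction k rule: int_induct[of _ 0])
    case (step1 i) then show ?case using up[of "1/2 + \<delta> + of_int i"] by (simp add: add_ac)
  next
    case (step2 i) then show ?case using down[of "1/2 + \<delta> + of_int (i - 1)"] by (simp add: algebra_simps)
  qed (use base in simp)
  then show ?thesis by (simp add: P_def \<delta>_def)
qed

theorem norm_Gamma_vertical_bigtheta:
  assumes "C \<noteq> 0"
  shows "(\<lambda>y. norm (Gamma (c + of_real C * (\<i> * of_real y)))) \<in> \<Theta>[at_infinity](stirling_growth (Re c - 1/2) \<bar>C\<bar>)"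
proof -
  define T where "T = (\<lambda>y. Im c + C * y)"
  have lim: "filterlim T at_infinity at_infinity"
    unfolding T_def using assms
    by (intro tendsto_add_filterlim_at_infinity[OF tendsto_const] tendsto_mult_filterlim_at_infinity[OF tendsto_const] filterlim_ident) auto
  have "(\<lambda>y. norm (Gamma (Complex (Re c) (T y)))) \<in> \<Theta>[at_infinity](\<lambda>y. stirling_growth (Re c - 1/2) 1 (T y))"
    by (rule landau_theta.compose[OF norm_Gamma_Complex_bigtheta lim])
  also have "(\<lambda>y. stirling_growth (Re c - 1/2) 1 (T y)) \<in> \<Theta>[at_infinity](stirling_growth (Re c - 1/2) \<bar>C\<bar>)"
  proof (rule landau_theta.mult)
    have "T \<in> \<Theta>[at_infinity](\<lambda>y. y)"
    proof (rule bigthetaI'[of "\<bar>C\<bar> / 2" "2 * \<bar>C\<bar>"])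
      show "\<forall>\<^sub>F y in at_infinity. \<bar>C\<bar> / 2 * norm y \<le> norm (T y) \<and> norm (T y) \<le> 2 * \<bar>C\<bar> * norm y"
      proof (rule eventually_mono[OF eventually_at_infinity_abs_ge[of "2 * \<bar>Im c\<bar> / \<bar>C\<bar>"]])
        fix y assume "2 * \<bar>Im c\<bar> / \<bar>C\<bar> \<le> \<bar>y\<bar>"
        then have "2 * \<bar>Im c\<bar> \<le> \<bar>C * y\<bar>" using assms by (simp add: field_simps abs_mult)
        then have "\<bar>C * y\<bar> / 2 \<le> \<bar>Im c + C * y\<bar> \<and> \<bar>Im c + C * y\<bar> \<le> 2 * \<bar>C * y\<bar>" by linarith
        then show "\<bar>C\<bar> / 2 * norm y \<le> norm (T y) \<and> norm (T y) \<le> 2 * \<bar>C\<bar> * norm y"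
          by (simp add: T_def abs_mult)
      qed
    qed (use assms in auto)
    then show "(\<lambda>y. \<bar>T y\<bar> powr (Re c - 1/2)) \<in> \<Theta>[at_infinity](\<lambda>y. \<bar>y\<bar> powr (Re c - 1/2))"
      by (rule bigtheta_powr)
    show "(\<lambda>y. exp (- (pi / 2 * 1 * \<bar>T y\<bar>))) \<in> \<Theta>[at_infinity](\<lambda>y. exp (- (pi / 2 * \<bar>C\<bar> * \<bar>y\<bar>)))"
    proof (rule bigthetaI'[of "exp (- (pi / 2 * \<bar>Im c\<bar>))" "exp (pi / 2 * \<bar>Im c\<bar>)"], simp, simp, intro always_eventually allI)
      fix y
      have "\<bar>C\<bar> * \<bar>y\<bar> - \<bar>Im c\<bar> \<le> \<bar>T y\<bar>" "\<bar>T y\<bar> \<le> \<bar>C\<bar> * \<bar>y\<bar> + \<bar>Im c\<bar>"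
        unfolding T_def abs_mult[symmetric] by linarith+
      then have "pi / 2 * (\<bar>C\<bar> * \<bar>y\<bar> - \<bar>Im c\<bar>) \<le> pi / 2 * \<bar>T y\<bar>" "pi / 2 * \<bar>T y\<bar> \<le> pi / 2 * (\<bar>C\<bar> * \<bar>y\<bar> + \<bar>Im c\<bar>)"
        by (auto intro!: mult_left_mono simp del: times_divide_eq_left)
      then show "exp (- (pi / 2 * \<bar>Im c\<bar>)) * norm (exp (- (pi / 2 * \<bar>C\<bar> * \<bar>y\<bar>))) \<le> norm (exp (- (pi / 2 * 1 * \<bar>T y\<bar>))) \<and>
        norm (exp (- (pi / 2 * 1 * \<bar>T y\<bar>))) \<le> exp (pi / 2 * \<bar>Im c\<bar>) * norm (exp (- (pi / 2 * \<bar>C\<bar> * \<bar>y\<bar>)))"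
        unfolding norm_exp real_norm_def abs_exp_cancel exp_add[symmetric] exp_le_cancel_iff
        by (auto simp: algebra_simps)
    qed
  qed
  also have "(\<lambda>y. norm (Gamma (Complex (Re c) (T y)))) = (\<lambda>y. norm (Gamma (c + of_real C * (\<i> * of_real y))))"
    by (intro ext arg_cong[where f = "\<lambda>z. norm (Gamma z)"]) (simp add: T_def complex_eq_iff)
  finally show ?thesis .
qed

section \<open>Absolute convergence of the I-function\<close>

text \<open>
The modulus of a power with real exponent does not depend on the branch. At a pole both sides vanish,
since \<open>Gamma\<close> has the value \<open>0\<close> there and \<open>0 powr \<kappa> = 0\<close>.
\<close>

lemma norm_branch:
  assumes G: "gamma_power_branches G" and s: "Re s = 0"
  shows "norm (G c C \<kappa> s) = norm (Gamma (c + of_real C * s)) powr \<kappa>"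
proof (cases "c + of_real C * s \<in> \<int>\<^sub>\<le>\<^sub>0")
  case True
  then have "G c C \<kappa> s = 0" using G s unfolding gamma_power_branches_def by blast
  then show ?thesis using True by (simp add: Gamma_eq_zero_iff[THEN iffD2])
next
  case False
  then obtain l where l: "exp l = Gamma (c + of_real C * s)" "G c C \<kappa> s = exp (of_real \<kappa> * l)"
    using G s unfolding gamma_power_branches_def by metis
  then show ?thesis unfolding l(1)[symmetric] l(2) norm_exp_eq_Re by (simp add: exp_powr_real mult.commute)
qed

text \<open>
Two logarithms of the same number differ by a multiple of \<open>2\<pi>i\<close>, which exponentiation with \<open>\<kappa> = 1\<close>
forgets. The two triples that the fractional derivative adds have this exponent.
\<close>

lemma branch_exponent_one:
  assumes G: "gamma_power_branches G" and s: "Re s = 0"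
  shows "G c C 1 s = Gamma (c + of_real C * s)"
proof (cases "c + of_real C * s \<in> \<int>\<^sub>\<le>\<^sub>0")
  case True
  then have "G c C 1 s = 0" using G s unfolding gamma_power_branches_def by blast
  then show ?thesis using True by (simp add: Gamma_eq_zero_iff[THEN iffD2])
next
  case False
  then obtain l where "exp l = Gamma (c + of_real C * s)" "G c C 1 s = exp (of_real 1 * l)"
    using G s unfolding gamma_power_branches_def by metis
  then show ?thesis by simp
qed

text \<open>
The branch is continuous off the closed set of poles and \<open>0\<close> on it.
\<close>

lemma branch_measurable:
  assumes G: "gamma_power_branches G"
  shows "(\<lambda>y. G c C \<kappa> (\<i> * of_real y)) \<in> borel_measurable borel"
proof -
  define U where "U = {y::real. c + of_real C * (\<i> * of_real y) \<notin> \<int>\<^sub>\<le>\<^sub>0}"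
  have "open U"
  proof -
    have "U = - ((\<lambda>y. c + of_real C * (\<i> * of_real y)) -` \<int>\<^sub>\<le>\<^sub>0)" by (auto simp: U_def)
    then show ?thesis by (auto intro!: open_Compl closed_vimage continuous_intros)
  qed
  moreover have "continuous_on U (\<lambda>y. G c C \<kappa> (\<i> * of_real y))"
  proof (rule continuous_on_compose2[of "{s. Re s = 0 \<and> c + of_real C * s \<notin> \<int>\<^sub>\<le>\<^sub>0}" "G c C \<kappa>"])
    show "continuous_on {s. Re s = 0 \<and> c + of_real C * s \<notin> \<int>\<^sub>\<le>\<^sub>0} (G c C \<kappa>)"
      using G unfolding gamma_power_branches_def by blast
  qed (auto simp: U_def intro!: continuous_intros)
  ultimately have "(\<lambda>y. indicator U y *\<^sub>R G c C \<kappa> (\<i> * of_real y)) \<in> borel_measurable borel"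
    by (intro borel_measurable_continuous_on_indicator) auto
  also have "(\<lambda>y. indicator U y *\<^sub>R G c C \<kappa> (\<i> * of_real y)) = (\<lambda>y. G c C \<kappa> (\<i> * of_real y))"
  proof
    fix y
    have "G c C \<kappa> (\<i> * of_real y) = 0" if "y \<notin> U"
      using G that unfolding gamma_power_branches_def U_def by auto
    then show "indicator U y *\<^sub>R G c C \<kappa> (\<i> * of_real y) = G c C \<kappa> (\<i> * of_real y)"
      by (auto simp: indicator_def)
  qed
  finally show ?thesis .
qed

lemma borel_measurable_prod_list:
  fixes f :: "'b \<Rightarrow> 'a \<Rightarrow> complex"
  assumes "\<And>t. t \<in> set ts \<Longrightarrow> f t \<in> borel_measurable M"
  shows "(\<lambda>y. \<Prod>t\<leftarrow>ts. f t y) \<in> borel_measurable M"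
  using assms by (induction ts) auto

lemma I_chi_measurable:
  assumes "gamma_power_branches G"
  shows "(\<lambda>y. I_chi G m n as bs (\<i> * of_real y)) \<in> borel_measurable borel"
  unfolding I_chi_def gfac_def gfac_refl_def case_prod_beta
  by (intro borel_measurable_divide borel_measurable_times borel_measurable_prod_list branch_measurable assms)

text \<open>
The power exponent and, up to the factor \<open>\<pi>/2\<close>, the exponential rate that Stirling's formula gives for \<open>\<Gamma>(c + Cs)\<^sup>\<kappa>\<close> on the imaginary
axis. For the reflected factor \<open>\<Gamma>(1 - c - Cs)\<^sup>\<kappa>\<close> the first changes sign and the second does not.
\<close>

definition fac_growth :: "triple \<Rightarrow> real" where "fac_growth = (\<lambda>(c, C, \<kappa>). (Re c - 1/2) * \<kappa>)"
definition fac_decay :: "triple \<Rightarrow> real" where "fac_decay = (\<lambda>(c, C, \<kappa>). \<kappa> * C)"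

lemma branch_bigtheta:
  assumes G: "gamma_power_branches G" and "C \<noteq> 0"
  shows "(\<lambda>y. norm (G c C \<kappa> (\<i> * of_real y))) \<in> \<Theta>[at_infinity](stirling_growth ((Re c - 1/2) * \<kappa>) (\<kappa> * \<bar>C\<bar>))"
proof -
  have "(\<lambda>y. norm (Gamma (c + of_real C * (\<i> * of_real y))) powr \<kappa>)
     \<in> \<Theta>[at_infinity](\<lambda>y. abs (stirling_growth (Re c - 1/2) \<bar>C\<bar> y) powr \<kappa>)"
    using bigtheta_powr[OF norm_Gamma_vertical_bigtheta[OF assms(2), of c], of \<kappa>] by simp
  also have "(\<lambda>y. abs (stirling_growth (Re c - 1/2) \<bar>C\<bar> y) powr \<kappa>) = stirling_growth ((Re c - 1/2) * \<kappa>) (\<kappa> * \<bar>C\<bar>)"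
    by (simp add: fun_eq_iff abs_mult powr_mult powr_powr exp_powr_real mult_ac)
  finally show ?thesis using norm_branch[OF G] by simp
qed

lemma gfac_bigtheta:
  assumes "gamma_power_branches G" and "fst (snd t) > 0"
  shows "(\<lambda>y. norm (gfac G t (\<i> * of_real y))) \<in> \<Theta>[at_infinity](stirling_growth (fac_growth t) (fac_decay t))"
    and "(\<lambda>y. norm (gfac_refl G t (\<i> * of_real y))) \<in> \<Theta>[at_infinity](stirling_growth (- fac_growth t) (fac_decay t))"
proof -
  obtain c C \<kappa> where t: "t = (c, C, \<kappa>)" by (cases t)
  have e: "(Re (1 - c) - 1/2) * \<kappa> = - ((Re c - 1/2) * \<kappa>)" by (simp add: algebra_simps)
  show "(\<lambda>y. norm (gfac G t (\<i> * of_real y))) \<in> \<Theta>[at_infinity](stirling_growth (fac_growth t) (fac_decay t))"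
    using branch_bigtheta[OF assms(1), of C c \<kappa>] assms(2)
    by (simp add: t gfac_def fac_growth_def fac_decay_def)
  show "(\<lambda>y. norm (gfac_refl G t (\<i> * of_real y))) \<in> \<Theta>[at_infinity](stirling_growth (- fac_growth t) (fac_decay t))"
    using branch_bigtheta[OF assms(1), of "- C" "1 - c" \<kappa>] assms(2) unfolding e
    by (simp add: t gfac_refl_def fac_growth_def fac_decay_def)
qed

lemma stirling_growth_mult:
  "stirling_growth r d y * stirling_growth r' d' y = stirling_growth (r + r') (d + d') y"
proof -
  have "exp (- (pi / 2 * d * \<bar>y\<bar>)) * exp (- (pi / 2 * d' * \<bar>y\<bar>)) = exp (- (pi / 2 * (d + d') * \<bar>y\<bar>))"
    unfolding mult_exp_exp by (simp add: ring_distribs)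
  then show ?thesis
    by (simp add: powr_add mult_ac)
qed

lemma stirling_growth_divide:
  "stirling_growth r d y / stirling_growth r' d' y = stirling_growth (r - r') (d - d') y"
proof -
  have "exp (- (pi / 2 * d * \<bar>y\<bar>)) / exp (- (pi / 2 * d' * \<bar>y\<bar>)) = exp (- (pi / 2 * (d - d') * \<bar>y\<bar>))"
    unfolding exp_diff[symmetric] by (simp add: left_diff_distrib right_diff_distrib)
  then show ?thesis
    by (simp only: powr_diff times_divide_times_eq[symmetric])
qed

lemma prod_list_bigtheta:
  fixes f :: "'b \<Rightarrow> real \<Rightarrow> complex"
  assumes "\<And>t. t \<in> set ts \<Longrightarrow> (\<lambda>y. norm (f t y)) \<in> \<Theta>[at_infinity](stirling_growth (r t) (d t))"
  shows "(\<lambda>y. norm (\<Prod>t\<leftarrow>ts. f t y)) \<in> \<Theta>[at_infinity](stirling_growth (\<Sum>t\<leftarrow>ts. r t) (\<Sum>t\<leftarrow>ts. d t))"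
  using assms
proof (induction ts)
  case Nil
  show ?case
    by (intro bigthetaI_cong eventually_mono[OF eventually_at_infinity_abs_ge[of 1]]) auto
next
  case (Cons t ts)
  have "(\<lambda>y. norm (f t y) * norm (\<Prod>t\<leftarrow>ts. f t y)) \<in>
      \<Theta>[at_infinity](\<lambda>y. stirling_growth (r t) (d t) y * stirling_growth (\<Sum>t\<leftarrow>ts. r t) (\<Sum>t\<leftarrow>ts. d t) y)"
    using Cons by (intro landau_theta.mult) auto
  then show ?case unfolding stirling_growth_mult by (simp add: norm_mult)
qed

lemma sum_list_take_drop: "(\<Sum>t\<leftarrow>ts. f t) = (\<Sum>t\<leftarrow>take k ts. f t) + (\<Sum>t\<leftarrow>drop k ts. f t :: real)"
  by (metis append_take_drop_id map_append sum_list_append)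

text \<open>
The quantities \<open>\<Omega>\<close> and \<open>\<Delta>\<close> of the convergence conditions are the power and, up to the factor \<open>\<pi>/2\<close>, the exponential rate that
Stirling's formula gives for \<open>\<chi>\<close> on the imaginary axis.
\<close>

theorem I_chi_bigtheta:
  assumes G: "gamma_power_branches G" and pos: "\<And>t. t \<in> set as \<union> set bs \<Longrightarrow> fst (snd t) > 0"
  shows "(\<lambda>y. norm (I_chi G m n as bs (\<i> * of_real y))) \<in>
    \<Theta>[at_infinity](stirling_growth (I_Omega as bs) (I_Delta m n as bs))"
proof -
  have mem: "set (take k ts) \<subseteq> set ts" "set (drop k ts) \<subseteq> set ts" for k and ts :: "triple list"
    by (auto dest: in_set_takeD in_set_dropD)
  define S where "S = (\<lambda>ts. \<Sum>t\<leftarrow>ts. fac_growth t)"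
  define D where "D = (\<lambda>ts. \<Sum>t\<leftarrow>ts. fac_decay t)"
  have refl: "(\<Sum>t\<leftarrow>ts. - fac_growth t) = - S ts" for ts
    by (simp add: S_def uminus_sum_list_map o_def)
  have "(\<lambda>y. norm (I_chi G m n as bs (\<i> * of_real y))) \<in>
     \<Theta>[at_infinity](\<lambda>y. (stirling_growth (S (take m bs)) (D (take m bs)) y * stirling_growth (- S (take n as)) (D (take n as)) y) /
      (stirling_growth (- S (drop m bs)) (D (drop m bs)) y * stirling_growth (S (drop n as)) (D (drop n as)) y))"
    unfolding I_chi_def norm_divide norm_mult refl[symmetric] unfolding S_def D_def
    by (intro bigtheta_divide_filter landau_theta.mult prod_list_bigtheta gfac_bigtheta G pos)
       (use mem in blast)+
  moreover have "I_Omega as bs = S (take m bs) + - S (take n as) - (- S (drop m bs) + S (drop n as))"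
  proof -
    have "(\<Sum>(c, C, \<kappa>)\<leftarrow>ts. (1/2 - Re c) * \<kappa>) = - S ts" for ts
      unfolding refl[symmetric] by (rule arg_cong[where f = sum_list]) (auto simp: fac_growth_def algebra_simps)
    then show ?thesis
      using sum_list_take_drop[of fac_growth as n] sum_list_take_drop[of fac_growth bs m]
      unfolding I_Omega_def by (simp add: S_def)
  qed
  moreover have "I_Delta m n as bs = D (take m bs) + D (take n as) - (D (drop m bs) + D (drop n as))"
    by (simp add: I_Delta_def D_def fac_decay_def)
  ultimately show ?thesis
    by (simp only: stirling_growth_mult stirling_growth_divide)
qed

lemma continuous_on_prod_list:
  fixes f :: "'b \<Rightarrow> real \<Rightarrow> real"
  assumes "\<And>t. t \<in> set ts \<Longrightarrow> continuous_on S (f t)"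
  shows "continuous_on S (\<lambda>y. \<Prod>t\<leftarrow>ts. f t y)"
  using assms by (induction ts) (auto intro!: continuous_intros)

lemma norm_prod_list: "norm (\<Prod>t\<leftarrow>ts. f t) = (\<Prod>t\<leftarrow>ts. norm (f t :: complex))"
  by (induction ts) (auto simp: norm_mult)

lemma inverse_prod_list: "inverse (\<Prod>t\<leftarrow>ts. f t) = (\<Prod>t\<leftarrow>ts. inverse (f t :: real))"
  by (induction ts) auto

lemma continuous_on_norm_branch:
  assumes G: "gamma_power_branches G" and nonpole: "\<And>s. Re s = 0 \<Longrightarrow> c + of_real C * s \<notin> \<int>\<^sub>\<le>\<^sub>0"
  shows "continuous_on UNIV (\<lambda>y. norm (G c C \<kappa> (\<i> * of_real y)))"
  unfolding norm_branch[OF G, of "\<i> * of_real _", simplified]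
proof (rule continuous_on_powr)
  have *: "c + of_real C * (\<i> * of_real y) \<notin> \<int>\<^sub>\<le>\<^sub>0" for y
    by (rule nonpole) simp
  then show "\<forall>y\<in>UNIV. norm (Gamma (c + of_real C * (\<i> * of_real y))) \<noteq> 0"
    by (simp add: Gamma_eq_zero_iff)
  have "continuous_on UNIV (\<lambda>y. Gamma (c + of_real C * (\<i> * of_real y)))"
    by (rule continuous_on_compose2[OF continuous_on_Gamma[of "- \<int>\<^sub>\<le>\<^sub>0"]])
       (use * in \<open>auto intro!: continuous_intros\<close>)
  then show "continuous_on UNIV (\<lambda>y. norm (Gamma (c + of_real C * (\<i> * of_real y))))"
    by (rule continuous_on_norm)
qed auto

text \<open>
The reciprocal modulus of a factor is \<open>\<bar>1/\<Gamma>\<bar>\<close> to the power \<open>\<kappa> > 0\<close>, and \<open>1/\<Gamma>\<close> is entire; so it stays continuous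
at a pole of \<open>\<Gamma>\<close>, with the value \<open>inverse 0 = 0\<close>.
\<close>

lemma continuous_on_inverse_norm_branch:
  assumes G: "gamma_power_branches G" and "\<kappa> > 0"
  shows "continuous_on UNIV (\<lambda>y. inverse (norm (G c C \<kappa> (\<i> * of_real y))))"
proof -
  have "inverse (norm (G c C \<kappa> (\<i> * of_real y))) = norm (rGamma (c + of_real C * (\<i> * of_real y))) powr \<kappa>" for y
    using norm_branch[OF G, of "\<i> * of_real y" c C \<kappa>]
    by (simp add: rGamma_inverse_Gamma norm_inverse inverse_powr)
  moreover have "continuous_on UNIV (\<lambda>y. rGamma (c + of_real C * (\<i> * of_real y)))"
    by (rule continuous_on_compose2[OF continuous_on_rGamma[of UNIV]]) (auto intro!: continuous_intros)
  ultimately show ?thesis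
    using assms(2) by (simp only:) (intro continuous_on_powr' continuous_on_norm continuous_on_const, auto)
qed

text \<open>
The separation conditions keep the poles of the numerator off the imaginary axis; poles of the denominator
on it are harmless, being zeros of reciprocals.
\<close>

lemma I_admissible_continuous_norm_chi:
  assumes G: "gamma_power_branches G" and adm: "I_admissible m n as bs \<theta>"
  shows "continuous_on UNIV (\<lambda>y. norm (I_chi G m n as bs (\<i> * of_real y)))"
proof -
  have lower: "\<forall>(b, B, \<beta>)\<in>set (take m bs). \<forall>s. b + of_real B * s \<in> \<int>\<^sub>\<le>\<^sub>0 \<longrightarrow> Re s < 0"
    and upper: "\<forall>(a, A, \<alpha>)\<in>set (take n as). \<forall>s. 1 - a - of_real A * s \<in> \<int>\<^sub>\<le>\<^sub>0 \<longrightarrow> Re s > 0"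
    and as: "\<forall>(a, A, \<alpha>)\<in>set as. A > 0 \<and> \<alpha> > 0" and bs: "\<forall>(b, B, \<beta>)\<in>set bs. B > 0 \<and> \<beta> > 0"
    using adm unfolding I_admissible_def by blast+
  have "continuous_on UNIV (\<lambda>y. (\<Prod>t\<leftarrow>take m bs. norm (gfac G t (\<i> * of_real y))) * (\<Prod>t\<leftarrow>take n as. norm (gfac_refl G t (\<i> * of_real y))) *
     ((\<Prod>t\<leftarrow>drop m bs. inverse (norm (gfac_refl G t (\<i> * of_real y)))) * (\<Prod>t\<leftarrow>drop n as. inverse (norm (gfac G t (\<i> * of_real y))))))"
  proof (intro continuous_on_mult continuous_on_prod_list)
    fix t assume t: "t \<in> set (take m bs)"
    obtain c C \<kappa> where [simp]: "t = (c, C, \<kappa>)" by (cases t)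
    from bspec[OF lower t] have "c + of_real C * s \<notin> \<int>\<^sub>\<le>\<^sub>0" if "Re s = 0" for s
      using that by auto
    then show "continuous_on UNIV (\<lambda>y. norm (gfac G t (\<i> * of_real y)))"
      using continuous_on_norm_branch[OF G] by (simp add: gfac_def)
  next
    fix t assume t: "t \<in> set (take n as)"
    obtain c C \<kappa> where [simp]: "t = (c, C, \<kappa>)" by (cases t)
    from bspec[OF upper t] have "1 - c + of_real (- C) * s \<notin> \<int>\<^sub>\<le>\<^sub>0" if "Re s = 0" for s
      using that by auto
    then show "continuous_on UNIV (\<lambda>y. norm (gfac_refl G t (\<i> * of_real y)))"
      using continuous_on_norm_branch[OF G] by (simp add: gfac_refl_def)
  next
    fix t assume "t \<in> set (drop m bs)"
    then have "t \<in> set bs" by (rule in_set_dropD)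
    then have "snd (snd t) > 0" using bs by auto
    then show "continuous_on UNIV (\<lambda>y. inverse (norm (gfac_refl G t (\<i> * of_real y))))"
      using continuous_on_inverse_norm_branch[OF G] by (cases t) (simp add: gfac_refl_def)
  next
    fix t assume "t \<in> set (drop n as)"
    then have "t \<in> set as" by (rule in_set_dropD)
    then have "snd (snd t) > 0" using as by auto
    then show "continuous_on UNIV (\<lambda>y. inverse (norm (gfac G t (\<i> * of_real y))))"
      using continuous_on_inverse_norm_branch[OF G] by (cases t) (simp add: gfac_def)
  qed
  then show ?thesis
    unfolding I_chi_def norm_divide norm_mult norm_prod_list
    unfolding divide_inverse inverse_mult_distrib inverse_prod_list .
qed

lemma integrable_continuous_bigo_powr:
  fixes f :: "real \<Rightarrow> complex"
  assumes meas: "f \<in> borel_measurable borel" and cont: "continuous_on UNIV (\<lambda>y. norm (f y))"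
    and big: "(\<lambda>y. norm (f y)) \<in> O[at_infinity](\<lambda>y. \<bar>y\<bar> powr r)" and r: "r < -1"
  shows "integrable lborel f"
proof -
  from landau_o.bigE[OF big] obtain M where M: "M > 0" "\<forall>\<^sub>F y in at_infinity. norm (norm (f y)) \<le> M * norm (\<bar>y\<bar> powr r)"
    by blast
  then obtain R0 where R0: "\<And>y. \<bar>y\<bar> \<ge> R0 \<Longrightarrow> norm (f y) \<le> M * \<bar>y\<bar> powr r"
    by (auto simp: eventually_at_infinity)
  define R where "R = max R0 1"
  have R: "R \<ge> 1" "\<And>y. \<bar>y\<bar> \<ge> R \<Longrightarrow> norm (f y) \<le> M * \<bar>y\<bar> powr r"
    using R0 by (auto simp: R_def)
  have "compact ((\<lambda>y. norm (f y)) ` {-R..R})"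
    by (intro compact_continuous_image continuous_on_subset[OF cont]) auto
  then have "\<exists>B. \<forall>y\<in>{-R..R}. norm (f y) \<le> B"
    by (auto dest!: compact_imp_bounded simp: bounded_iff)
  then obtain B where B: "\<And>y. y \<in> {-R..R} \<Longrightarrow> norm (f y) \<le> B"
    by blast
  define p where "p = (\<lambda>y. indicator {1..} y * y powr r)"
  have p: "integrable lborel p"
  proof -
    have "(\<lambda>y. y powr r) absolutely_integrable_on {1..}"
      using has_integral_powr_to_inf[OF r, of 1]
      by (subst absolutely_integrable_on_iff_nonneg) (auto simp: has_integral_iff)
    then show ?thesis
      by (simp add: set_integrable_def p_def integrable_completion)
  qed
  have p': "integrable lborel (\<lambda>y. p (- y))"
    using lborel_integrable_real_affine[OF p, of "-1" 0] by simp
  show ?thesis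
  proof (rule Bochner_Integration.integrable_bound)
    show "integrable lborel (\<lambda>y. B * indicator {-R..R} y + M * p y + M * p (- y))"
      using p p' R by (intro Bochner_Integration.integrable_add integrable_mult_right integrable_real_indicator) auto
    show "AE y in lborel. norm (f y) \<le> norm (B * indicator {-R..R} y + M * p y + M * p (- y))"
    proof (intro AE_I2)
      fix y
      have B0: "0 \<le> B" using order_trans[OF norm_ge_zero B[of 0]] R by simp
      have pp: "0 \<le> M * p y" "0 \<le> M * p (- y)" using M by (auto simp: p_def)
      have "norm (f y) \<le> B * indicator {-R..R} y + M * p y + M * p (- y)"
      proof (cases "y \<in> {-R..R}")
        case True
        then show ?thesis using B[OF True] pp by simp
      next
        case False
        then have "\<bar>y\<bar> > R" by auto
        then have "norm (f y) \<le> M * \<bar>y\<bar> powr r" by (intro R) auto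
        also have "\<bar>y\<bar> powr r = p y + p (- y)"
          using \<open>\<bar>y\<bar> > R\<close> R(1) by (cases "y \<ge> 0") (auto simp: p_def)
        finally show ?thesis using False by (simp add: ring_distribs)
      qed
      then show "norm (f y) \<le> norm (B * indicator {-R..R} y + M * p y + M * p (- y))" by simp
    qed
  qed (use meas in simp)
qed

text \<open>
The factor \<open>z\<^bsup>-s\<^esup>\<close> contributes at most \<open>e\<^bsup>\<bar>\<theta>\<bar> \<bar>y\<bar>\<^esup>\<close>. If \<open>\<bar>\<theta>\<bar> < \<pi>\<Delta>/2\<close> the integrand decays exponentially; if
\<open>\<bar>\<theta>\<bar> = \<pi>\<Delta>/2\<close> the exponentials cancel and the power \<open>\<Omega> < -1\<close> remains. On bounded intervals the
integrand is bounded because its modulus is continuous.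
\<close>

theorem I_admissible_integrable:
  assumes G: "gamma_power_branches G" and adm: "I_admissible m n as bs \<theta>"
  shows "integrable lborel (\<lambda>y. I_chi G m n as bs (\<i> * of_real y) * exp (- (\<i> * of_real y) * (of_real L + \<i> * of_real \<theta>)))"
    (is "integrable lborel ?f")
proof -
  define \<Delta> where "\<Delta> = I_Delta m n as bs"
  define \<Omega> where "\<Omega> = I_Omega as bs"
  have norm_f: "norm (?f y) = norm (I_chi G m n as bs (\<i> * of_real y)) * exp (\<theta> * y)" for y
    by (simp add: norm_mult algebra_simps)
  have chi: "(\<lambda>y. norm (I_chi G m n as bs (\<i> * of_real y))) \<in> \<Theta>[at_infinity](stirling_growth \<Omega> \<Delta>)"
    unfolding \<Omega>_def \<Delta>_def
    by (rule I_chi_bigtheta[OF G]) (use adm in \<open>fastforce simp: I_admissible_def\<close>)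
  have "(\<lambda>y. exp (\<theta> * y)) \<in> O[at_infinity](\<lambda>y. exp (\<bar>\<theta>\<bar> * \<bar>y\<bar>))"
    by (intro landau_o.big_mono always_eventually allI) (simp flip: abs_mult)
  from landau_o.big.mult[OF bigthetaD1[OF chi] this]
  have "(\<lambda>y. norm (?f y)) \<in> O[at_infinity](\<lambda>y. stirling_growth \<Omega> \<Delta> y * exp (\<bar>\<theta>\<bar> * \<bar>y\<bar>))"
    unfolding norm_f .
  also have "(\<lambda>y. stirling_growth \<Omega> \<Delta> y * exp (\<bar>\<theta>\<bar> * \<bar>y\<bar>)) = (\<lambda>y. \<bar>y\<bar> powr \<Omega> * exp (- ((pi / 2 * \<Delta> - \<bar>\<theta>\<bar>) * \<bar>y\<bar>)))"
    by (simp add: fun_eq_iff exp_add[symmetric] algebra_simps mult_exp_exp)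
  finally have big: "(\<lambda>y. norm (?f y)) \<in> O[at_infinity](\<lambda>y. \<bar>y\<bar> powr \<Omega> * exp (- ((pi / 2 * \<Delta> - \<bar>\<theta>\<bar>) * \<bar>y\<bar>)))" .
  have "\<exists>r. r < -1 \<and> (\<lambda>y. norm (?f y)) \<in> O[at_infinity](\<lambda>y. \<bar>y\<bar> powr r)"
  proof -
    have "I_abs_conv 0 m n as bs \<theta>" using adm by (simp add: I_admissible_def)
    then consider "\<bar>\<theta>\<bar> < pi / 2 * \<Delta>" | "\<bar>\<theta>\<bar> = pi / 2 * \<Delta>" "\<Omega> < -1"
      by (auto simp: I_abs_conv_def Let_def \<Delta>_def \<Omega>_def)
    then show ?thesis
    proof cases
      case 1
      define e where "e = pi / 2 * \<Delta> - \<bar>\<theta>\<bar>"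
      have "((\<lambda>t. t powr (\<Omega> + 2) / exp (e * t)) \<longlongrightarrow> 0) at_top"
      proof (rule Lim_null_comparison)
        define k where "k = nat \<lceil>\<Omega> + 2\<rceil>"
        have e: "e > 0" using 1 by (simp add: e_def)
        have "((\<lambda>t. (e * t) ^ k / exp (e * t)) \<longlongrightarrow> 0) at_top"
          by (rule filterlim_compose[OF tendsto_power_div_exp_0 filterlim_tendsto_pos_mult_at_top[OF tendsto_const e filterlim_ident]])
        from tendsto_mult_right_zero[OF this, of "inverse (e ^ k)"]
        show "((\<lambda>t. inverse (e ^ k) * ((e * t) ^ k / exp (e * t))) \<longlongrightarrow> 0) at_top" .
        show "\<forall>\<^sub>F t in at_top. norm (t powr (\<Omega> + 2) / exp (e * t)) \<le> inverse (e ^ k) * ((e * t) ^ k / exp (e * t))"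
        proof (rule eventually_mono[OF eventually_ge_at_top[of 1]])
          fix t :: real assume t: "t \<ge> 1"
          have "\<Omega> + 2 \<le> real k" unfolding k_def by linarith
          then have "t powr (\<Omega> + 2) \<le> t ^ k"
            using powr_mono[of "\<Omega> + 2" "real k" t] t by (simp add: powr_realpow)
          then have "t powr (\<Omega> + 2) / exp (e * t) \<le> t ^ k / exp (e * t)"
            by (rule divide_right_mono) simp
          also have "t ^ k / exp (e * t) = inverse (e ^ k) * ((e * t) ^ k / exp (e * t))"
            using e by (simp add: power_mult_distrib divide_inverse)
          finally show "norm (t powr (\<Omega> + 2) / exp (e * t)) \<le> inverse (e ^ k) * ((e * t) ^ k / exp (e * t))"
            by simp
        qed
      qed
      then have "((\<lambda>y. \<bar>y\<bar> powr (\<Omega> + 2) / exp (e * \<bar>y\<bar>)) \<longlongrightarrow> 0) at_infinity"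
        using filterlim_compose[OF _ filterlim_norm_at_top[where 'a = real]] by simp
      then have "(\<lambda>y. \<bar>y\<bar> powr (\<Omega> + 2) / exp (e * \<bar>y\<bar>)) \<in> O[at_infinity](\<lambda>_. 1 :: real)"
        by (intro bigoI_tendsto) auto
      then have "(\<lambda>y. \<bar>y\<bar> powr (-2) * (\<bar>y\<bar> powr (\<Omega> + 2) / exp (e * \<bar>y\<bar>))) \<in> O[at_infinity](\<lambda>y. \<bar>y\<bar> powr (-2) * 1)"
        by (intro landau_o.big.mult) auto
      also have "(\<lambda>y. \<bar>y\<bar> powr (-2) * (\<bar>y\<bar> powr (\<Omega> + 2) / exp (e * \<bar>y\<bar>))) = (\<lambda>y. \<bar>y\<bar> powr \<Omega> * exp (- (e * \<bar>y\<bar>)))"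
        by (simp add: fun_eq_iff exp_minus divide_inverse flip: powr_add)
      finally show ?thesis
        using landau_o.big_trans[OF big] unfolding e_def by (intro exI[of _ "-2"]) simp
    next
      case 2
      then have "pi / 2 * \<Delta> - \<bar>\<theta>\<bar> = 0" by simp
      with big have "(\<lambda>y. norm (?f y)) \<in> O[at_infinity](\<lambda>y. \<bar>y\<bar> powr \<Omega>)"
        by (simp only: mult_zero_left minus_zero exp_zero mult_1_right)
      then show ?thesis using 2 by blast
    qed
  qed
  then obtain r where r: "r < -1" "(\<lambda>y. norm (?f y)) \<in> O[at_infinity](\<lambda>y. \<bar>y\<bar> powr r)" by blast
  have "continuous_on UNIV (\<lambda>y. norm (?f y))"
    unfolding norm_f by (intro continuous_intros I_admissible_continuous_norm_chi[OF G adm])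
  moreover have "?f \<in> borel_measurable borel"
    by (intro borel_measurable_times I_chi_measurable G borel_measurable_continuous_onI continuous_intros)
  ultimately show ?thesis
    using r by (intro integrable_continuous_bigo_powr)
qed

section \<open>The Saigo integral of a power\<close>

lemma of_real_powr_exp: "r > 0 \<Longrightarrow> complex_of_real r powr z = exp (z * of_real (ln r))"
  by (simp add: powr_def Ln_of_real)

lemma isCont_hyp2F1:
  assumes "Re c > 0" "norm z < 1"
  shows "isCont (hyp2F1 a b c) z"
proof -
  define r where "r = (1 + norm z) / 2"
  have r: "norm z < r" "r < 1" "r > 0" using assms norm_ge_zero[of z] unfolding r_def by (auto simp del: norm_ge_zero)
  have "summable (\<lambda>k. gauss_coeff a b c k * of_real r ^ k)"
    using r assms by (intro summable_norm_cancel[OF summable_gauss_coeff_power]) auto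
  then have "isCont (\<lambda>z. \<Sum>k. gauss_coeff a b c k * z ^ k) z"
    using r by (intro isCont_powser) auto
  then show ?thesis by (simp add: hyp2F1_eq_suminf[abs_def])
qed

text \<open>
The substitution \<open>t = x/(1-u)\<close> turns \<open>1 - x/t\<close> into \<open>u\<close> and the Saigo integral of a power into an Euler
integral of \<open>\<^sub>2F\<^sub>1\<close> against the Beta kernel with exponents \<open>\<alpha>\<close> and \<open>w + \<beta>\<close>.
\<close>

theorem saigo_integral_powr:
  assumes \<alpha>: "Re \<alpha> > 0" and x: "x > 0" and \<beta>: "Re (w + \<beta>) > 0" and \<gamma>: "Re (w + \<gamma>) > 0"
  defines "K \<equiv> saigo_integrand \<alpha> \<beta> \<gamma> (\<lambda>t. of_real t powr (- w)) x"
  shows "set_integrable lborel {x<..} K"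
    and "(LINT t:{x<..}|lborel. K t) = of_real x powr (- w - \<beta>) *
      (Gamma \<alpha> * Gamma (w + \<beta>) * Gamma (w + \<gamma>) * rGamma w * rGamma (w + \<alpha> + \<beta> + \<gamma>))"
proof -
  define g where "g = (\<lambda>u. x / (1 - u))"
  define g' where "g' = (\<lambda>u. x / (1 - u) ^ 2)"
  define F where "F = (\<lambda>u. hyp2F1 (\<alpha> + \<beta>) (- \<gamma>) \<alpha> (of_real u) * beta_kernel \<alpha> (w + \<beta>) u)"
  have F: "set_integrable lborel {0<..<1} F"
    "(LINT u:{0<..<1}|lborel. F u) = Gamma \<alpha> * Gamma (w + \<beta>) * Gamma (w + \<gamma>) * rGamma w * rGamma (w + \<alpha> + \<beta> + \<gamma>)"
  proof -
    have "Re (\<alpha> + \<beta> + - \<gamma>) < Re (\<alpha> + (w + \<beta>))" using \<gamma> by simp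
    note * = hyp2F1_beta_integral[OF \<alpha> \<beta> this]
    show "set_integrable lborel {0<..<1} F" unfolding F_def by (rule *)
    have eqs: "\<alpha> + (w + \<beta>) - (\<alpha> + \<beta>) = w" "\<alpha> + (w + \<beta>) - - \<gamma> = w + \<alpha> + \<beta> + \<gamma>"
      "w - - \<gamma> = w + \<gamma>" by simp_all
    show "(LINT u:{0<..<1}|lborel. F u) = Gamma \<alpha> * Gamma (w + \<beta>) * Gamma (w + \<gamma>) * rGamma w * rGamma (w + \<alpha> + \<beta> + \<gamma>)"
      using *(2) unfolding F_def eqs .
  qed
  have subst_eq: "of_real (g' u) * K (g u) = of_real x powr (- w - \<beta>) * F u" if u: "u \<in> {0<..<1}" for u
  proof -
    define l where "l = complex_of_real (ln x)"
    define lu where "lu = complex_of_real (ln u)"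
    define lv where "lv = complex_of_real (ln (1 - u))"
    have pos: "0 < u" "0 < 1 - u" "g u > 0" "g u - x > 0" "g' u > 0"
      using u x by (auto simp: g_def g'_def field_simps)
    have sub: "g u - x = x * u / (1 - u)" using u by (simp add: g_def field_simps)
    have "g' u = exp (ln x - 2 * ln (1 - u))"
      using pos x by (simp add: g'_def exp_diff exp_double)
    then have 0: "complex_of_real (g' u) = exp (l - 2 * lv)"
      by (simp add: l_def lv_def flip: exp_of_real)
    have 1: "complex_of_real (ln (g u - x)) = l + lu - lv"
      using pos x unfolding sub by (simp add: ln_div ln_mult l_def lu_def lv_def)
    have 2: "complex_of_real (ln (g u)) = l - lv"
      using pos x by (simp add: g_def ln_div l_def lv_def)
    have 3: "1 - x / g u = u" using pos x by (simp add: g_def)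
    \<comment> \<open>All bases are positive, so the identity of powers is linear in the logarithms of \<open>x\<close>, \<open>u\<close> and \<open>1 - u\<close>.\<close>
    have "of_real (g' u) * (of_real (g u - x) powr (\<alpha> - 1) * of_real (g u) powr (- \<alpha> - \<beta>) * of_real (g u) powr (- w)) =
       exp ((l - 2 * lv) + (\<alpha> - 1) * (l + lu - lv) + (- \<alpha> - \<beta>) * (l - lv) + (- w) * (l - lv))"
      using pos by (simp only: of_real_powr_exp 0 1 2 exp_add mult.assoc)
    also have "(l - 2 * lv) + (\<alpha> - 1) * (l + lu - lv) + (- \<alpha> - \<beta>) * (l - lv) + (- w) * (l - lv) =
       (- w - \<beta>) * l + (\<alpha> - 1) * lu + (w + \<beta> - 1) * lv"
      by (simp add: algebra_simps)
    also have "exp \<dots> = of_real x powr (- w - \<beta>) * beta_kernel \<alpha> (w + \<beta>) u"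
      using pos x by (simp only: of_real_powr_exp beta_kernel_def l_def lu_def lv_def exp_add mult.assoc)
    finally have "of_real (g' u) * (of_real (g u - x) powr (\<alpha> - 1) * of_real (g u) powr (- \<alpha> - \<beta>) * of_real (g u) powr (- w)) * hyp2F1 (\<alpha> + \<beta>) (- \<gamma>) \<alpha> (of_real u) =
       of_real x powr (- w - \<beta>) * F u"
      by (simp add: F_def mult_ac)
    then show ?thesis unfolding K_def saigo_integrand_def 3 by (simp add: mult_ac)
  qed
  have contK_on: "continuous_on {x<..} K"
  proof -
    have "isCont (\<lambda>t. hyp2F1 (\<alpha> + \<beta>) (- \<gamma>) \<alpha> (of_real (1 - x / t))) t" if t: "t > x" for t
    proof (rule isCont_o2[where g = "hyp2F1 (\<alpha> + \<beta>) (- \<gamma>) \<alpha>"])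
      show "isCont (\<lambda>t. complex_of_real (1 - x / t)) t"
        using t x by (intro continuous_intros) auto
      have "norm (complex_of_real (1 - x / t)) < 1"
        unfolding norm_of_real using t x by (auto simp: abs_less_iff field_simps)
      then show "isCont (hyp2F1 (\<alpha> + \<beta>) (- \<gamma>) \<alpha>) (complex_of_real (1 - x / t))"
        by (rule isCont_hyp2F1[OF \<alpha>])
    qed
    then have "continuous_on {x<..} (\<lambda>t. hyp2F1 (\<alpha> + \<beta>) (- \<gamma>) \<alpha> (of_real (1 - x / t)))"
      by (intro continuous_at_imp_continuous_on) auto
    then show ?thesis
      unfolding K_def saigo_integrand_def
      by (intro continuous_on_mult continuous_on_of_real_powr)
         (use x in \<open>auto intro!: continuous_intros\<close>)
  qed
  then have contK: "isCont K t" if "t > x" for t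
    using that by (simp add: continuous_on_eq_continuous_at)
  have der: "DERIV g u :> g' u" if "u < 1" for u
    unfolding g_def g'_def using that by (auto intro!: derivative_eq_intros simp: power2_eq_square)
  have contg': "isCont g' u" if "u < 1" for u
    unfolding g'_def using that by (intro continuous_intros) auto
  have gx: "g u > x" if "0 < u" "u < 1" for u
    using that x by (simp add: g_def field_simps)
  have limA: "((ereal \<circ> g \<circ> real_of_ereal) \<longlongrightarrow> ereal x) (at_right 0)"
  proof -
    have "(g \<longlongrightarrow> x / (1 - 0)) (at_right 0)" unfolding g_def by (intro tendsto_intros) auto
    then show ?thesis unfolding zero_ereal_def by (simp add: ereal_tendsto_simps)
  qed
  have limB: "((ereal \<circ> g \<circ> real_of_ereal) \<longlongrightarrow> \<infinity>) (at_left 1)"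
  proof -
    have "((\<lambda>u::real. 1 - u) \<longlongrightarrow> 1 - 1) (at_left 1)" by (intro tendsto_intros)
    then have "filterlim (\<lambda>u::real. inverse (1 - u)) at_top (at_left 1)"
      by (intro filterlim_inverse_at_top) (auto simp: eventually_at_filter)
    from filterlim_tendsto_pos_mult_at_top[OF tendsto_const x this]
    have "filterlim g at_top (at_left 1)" by (simp add: g_def divide_inverse)
    then show ?thesis unfolding one_ereal_def by (simp add: ereal_tendsto_simps tendsto_PInfty_eq_at_top)
  qed
  have einterval: "einterval 0 1 = {0<..<1}" "einterval (ereal x) \<infinity> = {x<..}"
    by (auto simp: zero_ereal_def one_ereal_def einterval_def)
  have bnd: "0 < u" "u < 1" if "0 < ereal u" "ereal u < 1" for u
    using that by (auto simp: zero_ereal_def one_ereal_def)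
  have g'_nonneg: "0 \<le> g' u" for u using x by (simp add: g'_def)
  have intF: "set_integrable lborel {0<..<1} (\<lambda>u. of_real (g' u) * K (g u))"
    by (subst set_integrable_cong[OF refl refl subst_eq]) (use F(1) in auto)
  have intN: "set_integrable lborel {0<..<1} (\<lambda>u. norm (K (g u)) * g' u)"
  proof -
    have "set_integrable lborel {0<..<1} (\<lambda>u. norm (of_real (g' u) * K (g u)))"
      by (rule set_integrable_norm[OF intF])
    then show ?thesis using g'_nonneg by (simp add: norm_mult mult.commute)
  qed
  \<comment> \<open>Substitution needs integrability on both sides; for the nonnegative function \<open>norm \<circ> K\<close> one side suffices.\<close>
  have "set_integrable lborel (einterval (ereal x) \<infinity>) (\<lambda>t. norm (K t))"
    by (rule interval_integral_substitution_nonneg(1)[where g = g and g' = g' and a = 0 and b = 1])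
       (use der contg' contK gx bnd g'_nonneg limA limB intN in \<open>auto simp: einterval\<close>)
  then have normK: "set_integrable lborel {x<..} (\<lambda>t. norm (K t))" by (simp add: einterval)
  show intK: "set_integrable lborel {x<..} K"
    by (rule set_integrable_continuous_bound[OF _ _ normK])
       (auto intro!: continuous_at_imp_continuous_on contK)
  have "(LBINT t=ereal x..\<infinity>. K t) = (LBINT u=0..1. g' u *\<^sub>R K (g u))"
    by (rule interval_integral_substitution_integrable)
       (use der contg' contK gx bnd g'_nonneg limA limB intF intK in \<open>auto simp: einterval scaleR_conv_of_real\<close>)
  then have "(LINT t:{x<..}|lborel. K t) = (LINT u:{0<..<1}|lborel. of_real (g' u) * K (g u))"
    by (simp add: interval_lebesgue_integral_def einterval scaleR_conv_of_real)
  also have "\<dots> = (LINT u:{0<..<1}|lborel. of_real x powr (- w - \<beta>) * F u)"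
    by (rule set_lebesgue_integral_cong) (auto simp: subst_eq)
  finally show "(LINT t:{x<..}|lborel. K t) = of_real x powr (- w - \<beta>) *
      (Gamma \<alpha> * Gamma (w + \<beta>) * Gamma (w + \<gamma>) * rGamma w * rGamma (w + \<alpha> + \<beta> + \<gamma>))"
    by (simp add: F(2))
qed

section \<open>Superpositions of powers\<close>

text \<open>
The factor \<open>t\<^bsup>i\<mu>y\<^esup>\<close> has modulus \<open>1\<close>, so the double integral is dominated by the product of two integrable
functions of one variable each.
\<close>

lemma mellin_fubini:
  fixes k h :: "real \<Rightarrow> complex"
  assumes x: "x > 0" and k: "set_integrable lborel {x<..} k" and h: "integrable lborel h"
  shows "set_integrable lborel {x<..} (\<lambda>t. k t * (LINT y|lborel. h y * of_real t powr (\<i> * of_real (\<mu> * y))))" (is ?A)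
    and "(LINT t:{x<..}|lborel. k t * (LINT y|lborel. h y * of_real t powr (\<i> * of_real (\<mu> * y)))) =
      (LINT y|lborel. h y * (LINT t:{x<..}|lborel. k t * of_real t powr (\<i> * of_real (\<mu> * y))))" (is ?B)
proof -
  define k' where "k' = (\<lambda>t. indicator {x<..} t *\<^sub>R k t)"
  have k': "integrable lborel k'" using k by (simp add: k'_def set_integrable_def)
  have [measurable]: "k' \<in> borel_measurable borel" "h \<in> borel_measurable borel"
    using k' h by auto
  define F where "F = (\<lambda>(t, y). k' t * (h y * exp (\<i> * of_real (\<mu> * y * ln t))))"
  have osc: "of_real t powr (\<i> * of_real (\<mu> * y)) = exp (\<i> * of_real (\<mu> * y * ln t))" if "t > x" for t y
    using that x by (simp add: of_real_powr_exp mult_ac)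
  have F_eq: "F (t, y) = indicator {x<..} t *\<^sub>R (k t * (h y * of_real t powr (\<i> * of_real (\<mu> * y))))" for t y
    using osc[of t y] by (auto simp: F_def k'_def indicator_def)
  have normF: "norm (F (t, y)) = norm (k' t) * norm (h y)" for t y
    by (simp add: F_def norm_mult)
  have meas: "F \<in> borel_measurable (lborel \<Otimes>\<^sub>M lborel)"
    unfolding F_def case_prod_beta by measurable
  have int: "integrable (lborel \<Otimes>\<^sub>M lborel) F"
  proof (rule lborel_pair.Fubini_integrable[OF meas])
    show "integrable lborel (\<lambda>t. LINT y|lborel. norm (F (t, y)))"
      unfolding normF using integrable_norm[OF k'] by simp
    show "AE t in lborel. integrable lborel (\<lambda>y. F (t, y))"
    proof (intro AE_I2)
      fix t
      show "integrable lborel (\<lambda>y. F (t, y))"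
      proof (rule Bochner_Integration.integrable_bound)
        show "integrable lborel (\<lambda>y. norm (k' t) * norm (h y))" using h by simp
        show "(\<lambda>y. F (t, y)) \<in> borel_measurable lborel" using meas by simp
      qed (simp add: normF)
    qed
  qed
  have inner_y: "(LINT y|lborel. F (t, y)) = indicator {x<..} t *\<^sub>R (k t * (LINT y|lborel. h y * of_real t powr (\<i> * of_real (\<mu> * y))))" for t
    unfolding F_eq by simp
  have inner_t: "(LINT t|lborel. F (t, y)) = h y * (LINT t:{x<..}|lborel. k t * of_real t powr (\<i> * of_real (\<mu> * y)))" for y
    unfolding F_eq set_lebesgue_integral_def
    by (simp flip: integral_mult_right_zero add: mult.left_commute)
  show ?A
    using lborel_pair.integrable_fst'[OF int] unfolding inner_y set_integrable_def .
  show ?B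
    using lborel_pair.Fubini_integral[of "\<lambda>t y. F (t, y)"] int
    unfolding inner_y inner_t set_lebesgue_integral_def by simp
qed

lemma has_vector_derivative_iff_quotient:
  fixes f :: "real \<Rightarrow> complex"
  shows "(f has_vector_derivative D) (at x) \<longleftrightarrow> ((\<lambda>h. (f (x + h) - f x) / of_real h) \<longlongrightarrow> D) (at 0)"
proof -
  have eq: "norm (f (x + h) - f x - h *\<^sub>R D) / norm h = norm ((f (x + h) - f x) / of_real h - D)" if "h \<noteq> 0" for h
  proof -
    have "(f (x + h) - f x) / of_real h - D = (f (x + h) - f x - h *\<^sub>R D) / of_real h"
      using that by (simp add: diff_divide_distrib scaleR_conv_of_real)
    then show ?thesis by (simp add: norm_divide)
  qed
  have "(f has_vector_derivative D) (at x) \<longleftrightarrow> ((\<lambda>h. norm (f (x + h) - f x - h *\<^sub>R D) / norm h) \<longlongrightarrow> 0) (at 0)"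
    unfolding has_vector_derivative_def has_derivative_at by (simp add: bounded_linear_scaleR_left)
  also have "\<dots> \<longleftrightarrow> ((\<lambda>h. norm ((f (x + h) - f x) / of_real h - D)) \<longlongrightarrow> 0) (at 0)"
    by (intro tendsto_cong, unfold eventually_at_filter, intro always_eventually allI impI eq)
  also have "\<dots> \<longleftrightarrow> ((\<lambda>h. (f (x + h) - f x) / of_real h) \<longlongrightarrow> D) (at 0)"
    by (simp add: tendsto_norm_zero_iff LIM_zero_iff)
  finally show ?thesis .
qed

text \<open>
By the mean value inequality the bound on the derivative also dominates the difference quotients.
\<close>

lemma has_vector_derivative_integral_dominated:
  fixes f f' :: "real \<Rightarrow> 'a \<Rightarrow> complex"
  assumes r: "r > 0"
    and int: "\<And>x. x \<in> ball x0 r \<Longrightarrow> integrable M (f x)"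
    and der: "\<And>x \<omega>. x \<in> ball x0 r \<Longrightarrow> ((\<lambda>x. f x \<omega>) has_vector_derivative f' x \<omega>) (at x)"
    and bound: "\<And>x \<omega>. x \<in> ball x0 r \<Longrightarrow> norm (f' x \<omega>) \<le> g \<omega>"
    and g: "integrable M g" and meas: "f' x0 \<in> borel_measurable M"
  shows "((\<lambda>x. LINT \<omega>|M. f x \<omega>) has_vector_derivative (LINT \<omega>|M. f' x0 \<omega>)) (at x0)"
  unfolding has_vector_derivative_iff_quotient
proof (subst tendsto_at_iff_sequentially, intro allI impI, unfold o_def)
  fix X :: "nat \<Rightarrow> real" assume X: "\<forall>i. X i \<in> UNIV - {0}" "X \<longlonglongrightarrow> 0"
  have x0: "x0 \<in> ball x0 r" using r by simp
  from X(2) have "\<forall>\<^sub>F i in sequentially. dist (X i) 0 < r" using r by (rule tendstoD)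
  then obtain N where N: "\<And>i. i \<ge> N \<Longrightarrow> \<bar>X i\<bar> < r" by (auto simp: eventually_sequentially)
  define Y where "Y = (\<lambda>i. X (i + N))"
  have Y: "Y i \<noteq> 0" "x0 + Y i \<in> ball x0 r" for i
    using X(1) N[of "i + N"] by (auto simp: Y_def dist_norm)
  have Y0: "Y \<longlonglongrightarrow> 0" unfolding Y_def using X(2) by (rule LIMSEQ_ignore_initial_segment)
  have "(\<lambda>i. LINT \<omega>|M. (f (x0 + Y i) \<omega> - f x0 \<omega>) / of_real (Y i)) \<longlonglongrightarrow> (LINT \<omega>|M. f' x0 \<omega>)"
  proof (rule integral_dominated_convergence[OF meas _ g])
    show "(\<lambda>\<omega>. (f (x0 + Y i) \<omega> - f x0 \<omega>) / of_real (Y i)) \<in> borel_measurable M" for i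
      using int[OF Y(2), of i] int[OF x0] by (intro borel_measurable_divide borel_measurable_diff) auto
    show "AE \<omega> in M. (\<lambda>i. (f (x0 + Y i) \<omega> - f x0 \<omega>) / of_real (Y i)) \<longlonglongrightarrow> f' x0 \<omega>"
    proof (intro AE_I2)
      fix \<omega>
      have "((\<lambda>h. (f (x0 + h) \<omega> - f x0 \<omega>) / of_real h) \<longlongrightarrow> f' x0 \<omega>) (at 0)"
        using der[OF x0] unfolding has_vector_derivative_iff_quotient .
      then show "(\<lambda>i. (f (x0 + Y i) \<omega> - f x0 \<omega>) / of_real (Y i)) \<longlonglongrightarrow> f' x0 \<omega>"
        by (rule filterlim_compose) (use Y Y0 in \<open>auto simp: filterlim_at\<close>)
    qed
    show "AE \<omega> in M. norm ((f (x0 + Y i) \<omega> - f x0 \<omega>) / of_real (Y i)) \<le> g \<omega>" for i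
    proof (intro AE_I2)
      fix \<omega>
      have "norm (f (x0 + Y i) \<omega> - f x0 \<omega>) \<le> g \<omega> * norm (x0 + Y i - x0)"
      proof (rule differentiable_bound[of "ball x0 r" "\<lambda>x. f x \<omega>" "\<lambda>x h. h *\<^sub>R f' x \<omega>"])
        show "((\<lambda>x. f x \<omega>) has_derivative (\<lambda>h. h *\<^sub>R f' x \<omega>)) (at x within ball x0 r)" if "x \<in> ball x0 r" for x
          using der[OF that] unfolding has_vector_derivative_def by (rule has_derivative_at_withinI)
        show "onorm (\<lambda>h. h *\<^sub>R f' x \<omega>) \<le> g \<omega>" if "x \<in> ball x0 r" for x
          using bound[OF that, of \<omega>]
          by (intro onorm_le) (simp add: mult.commute[of "g \<omega>"] mult_left_mono)
      qed (use x0 Y in auto)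
      then show "norm ((f (x0 + Y i) \<omega> - f x0 \<omega>) / of_real (Y i)) \<le> g \<omega>"
        using Y(1)[of i] by (simp add: norm_divide divide_le_eq)
    qed
  qed
  also have "(\<lambda>i. LINT \<omega>|M. (f (x0 + Y i) \<omega> - f x0 \<omega>) / of_real (Y i)) =
     (\<lambda>i. ((LINT \<omega>|M. f (x0 + Y i) \<omega>) - (LINT \<omega>|M. f x0 \<omega>)) / of_real (Y i))"
    using int Y(2) x0 by (intro ext) simp
  finally show "(\<lambda>i. ((LINT \<omega>|M. f (x0 + X i) \<omega>) - (LINT \<omega>|M. f x0 \<omega>)) / of_real (X i)) \<longlonglongrightarrow> (LINT \<omega>|M. f' x0 \<omega>)"
    unfolding Y_def by (rule LIMSEQ_offset)
qed

text \<open>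
The modulus of \<open>x\<^bsup>E - 1 + i\<mu>y\<^esup>\<close> does not depend on \<open>y\<close> and is bounded for \<open>x\<close> near \<open>x\<^sub>0 > 0\<close>, so a multiple of
\<open>\<bar>(E + i\<mu>y) h(y)\<bar>\<close> dominates all the derivatives in question.
\<close>

lemma mellin_has_vector_derivative:
  fixes h :: "real \<Rightarrow> complex"
  assumes x0: "x0 > 0" and h: "integrable lborel h"
    and h': "integrable lborel (\<lambda>y. (E + \<i> * of_real (\<mu> * y)) * h y)"
  shows "((\<lambda>x. LINT y|lborel. h y * of_real x powr (E + \<i> * of_real (\<mu> * y))) has_vector_derivative
    (LINT y|lborel. (E + \<i> * of_real (\<mu> * y)) * h y * of_real x0 powr (E - 1 + \<i> * of_real (\<mu> * y)))) (at x0)"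
proof -
  \<comment> \<open>One of the two summands bounds the power on \<open>[x\<^sub>0/2, 2x\<^sub>0]\<close>, according to the sign of its exponent.\<close>
  define C where "C = (x0 / 2) powr (Re E - 1) + (2 * x0) powr (Re E - 1)"
  have meas: "(\<lambda>y. p y * of_real x powr (F + \<i> * of_real (\<mu> * y))) \<in> borel_measurable lborel"
    if "p \<in> borel_measurable lborel" "x > 0" for p :: "real \<Rightarrow> complex" and x F
  proof -
    have "(\<lambda>y. exp ((F + \<i> * of_real (\<mu> * y)) * of_real (ln x))) \<in> borel_measurable borel"
      by (intro borel_measurable_continuous_onI continuous_intros)
    then show ?thesis using that(1) by (simp add: of_real_powr_exp[OF that(2)])
  qed
  have nrm: "norm (of_real x powr (F + \<i> * of_real (\<mu> * y))) = x powr Re F" if "x > 0" for x F y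
    using that by (subst norm_powr_real_powr) auto
  show ?thesis
  proof (rule has_vector_derivative_integral_dominated[where r = "x0 / 2"
        and g = "\<lambda>y. norm ((E + \<i> * of_real (\<mu> * y)) * h y) * C"])
    show "x0 / 2 > 0" using x0 by simp
    fix x assume "x \<in> ball x0 (x0 / 2)"
    then have "\<bar>x0 - x\<bar> < x0 / 2" by (simp add: dist_real_def)
    then have x: "x0 / 2 < x" "x < 2 * x0" "x > 0" using x0 by linarith+
    show "integrable lborel (\<lambda>y. h y * of_real x powr (E + \<i> * of_real (\<mu> * y)))"
    proof (rule Bochner_Integration.integrable_bound)
      show "integrable lborel (\<lambda>y. h y * of_real (x powr Re E))" using h by simp
    qed (use meas[of h x E] h x in \<open>auto simp: norm_mult nrm simp del: of_real_mult\<close>)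
    fix y
    have "((\<lambda>z. z powr (E + \<i> * of_real (\<mu> * y))) has_field_derivative
        (E + \<i> * of_real (\<mu> * y)) * of_real x powr (E + \<i> * of_real (\<mu> * y) - 1)) (at (of_real x))"
      using x by (auto intro!: derivative_eq_intros simp: complex_nonpos_Reals_iff)
    from has_vector_derivative_mult_right[OF has_vector_derivative_real_field[OF this], of "h y"]
    show "((\<lambda>x. h y * of_real x powr (E + \<i> * of_real (\<mu> * y))) has_vector_derivative
       (E + \<i> * of_real (\<mu> * y)) * h y * of_real x powr (E - 1 + \<i> * of_real (\<mu> * y))) (at x)"
      by (simp add: algebra_simps)
    have "x powr (Re E - 1) \<le> C"
    proof (cases "Re E - 1 \<ge> 0")
      case True
      then have "x powr (Re E - 1) \<le> (2 * x0) powr (Re E - 1)" using x by (intro powr_mono2) auto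
      then show ?thesis by (simp add: C_def add_increasing)
    next
      case False
      then have "x powr (Re E - 1) \<le> (x0 / 2) powr (Re E - 1)" using x x0 by (intro powr_mono2') auto
      then show ?thesis by (simp add: C_def add_increasing2)
    qed
    then show "norm ((E + \<i> * of_real (\<mu> * y)) * h y * of_real x powr (E - 1 + \<i> * of_real (\<mu> * y)))
        \<le> norm ((E + \<i> * of_real (\<mu> * y)) * h y) * C"
      using x unfolding norm_mult[of "_ * h y"] by (subst nrm) (auto intro!: mult_left_mono)
  next
    show "integrable lborel (\<lambda>y. norm ((E + \<i> * of_real (\<mu> * y)) * h y) * C)"
      by (intro integrable_mult_left integrable_norm h')
    show "(\<lambda>y. (E + \<i> * of_real (\<mu> * y)) * h y * of_real x0 powr (E - 1 + \<i> * of_real (\<mu> * y))) \<in> borel_measurable lborel"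
      using h' x0 by (intro meas) auto
  qed
qed

section \<open>The Erdelyi--Kober derivative of a superposition of powers\<close>

lemma Gamma_plus1_right_half_plane: "Re z > 0 \<Longrightarrow> Gamma (z + 1) = z * Gamma z"
  by (intro Gamma_plus1 right_half_plane_notin_nonpos_Ints)

text \<open>
The Erdelyi--Kober derivative of a superposition of powers \<open>x\<^bsup>-w\<^esup>\<close>, \<open>w = \<rho> - i\<mu>y\<close>, multiplies the weight by
\<open>\<Gamma>(w+\<alpha>+\<gamma>)/\<Gamma>(w+\<gamma>)\<close>. In the proof \<open>H k\<close> is the weight after \<open>k\<close> of the \<open>N\<close> derivatives. The Saigo
integral gives \<open>H 0\<close>, each derivative multiplies by \<open>w - N + k\<close>, and \<open>H N\<close> is the weight claimed. Since
\<open>\<bar>w - N + k\<bar> \<ge> Re \<rho> - N > 0\<close>, integrability of \<open>H N\<close> implies that of all earlier weights.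
\<close>

theorem erdelyi_kober_mellin:
  fixes f h :: "real \<Rightarrow> complex" and \<alpha> \<gamma> \<rho> :: complex and \<mu> :: real
  assumes \<alpha>: "Re \<alpha> > 0" and \<rho>: "Re \<rho> > real (saigo_order \<alpha>)" "Re (\<rho> + \<alpha> + \<gamma>) > 0"
    and h: "integrable lborel h"
    and f: "\<And>x. x > 0 \<Longrightarrow> f x = of_real x powr (- \<rho>) * (LINT y|lborel. h y * of_real x powr (\<i> * of_real (\<mu> * y)))"
  defines "hD \<equiv> \<lambda>y. h y * (Gamma (\<alpha> + \<gamma> + \<rho> - \<i> * of_real (\<mu> * y)) * rGamma (\<gamma> + \<rho> - \<i> * of_real (\<mu> * y)))"
  assumes hD: "integrable lborel hD"
    and x: "x > 0"
  shows "erdelyi_kober_deriv_exists \<gamma> \<alpha> f x"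
    and "erdelyi_kober_deriv \<gamma> \<alpha> f x =
      of_real x powr (- \<rho>) * (LINT y|lborel. hD y * of_real x powr (\<i> * of_real (\<mu> * y)))"
proof -
  define N where "N = saigo_order \<alpha>"
  have N: "real N = of_int (\<lfloor>Re \<alpha>\<rfloor> + 1)" using \<alpha> by (simp add: N_def saigo_order_def)
  have N\<alpha>: "Re (- \<alpha> + of_nat N) > 0" using N by simp
  have N\<rho>: "real N < Re \<rho>" using \<rho> by (simp add: N_def)
  define w where "w = (\<lambda>y. \<rho> - \<i> * of_real (\<mu> * y))"
  define H where "H = (\<lambda>k y. h y * (Gamma (w y - of_nat N + of_nat k) * Gamma (w y + (\<alpha> + \<gamma>)) * rGamma (w y) * rGamma (w y + \<gamma>)))"
  have w: "Re (w y) = Re \<rho>" for y by (simp add: w_def)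
  have H_Suc: "(w y - of_nat N + of_nat k) * H k y = H (Suc k) y" for k y
  proof -
    have "Gamma (w y - of_nat N + of_nat k + 1) = (w y - of_nat N + of_nat k) * Gamma (w y - of_nat N + of_nat k)"
      using N\<rho> by (intro Gamma_plus1_right_half_plane) (simp add: w)
    then show ?thesis by (simp add: H_def add_ac mult_ac)
  qed
  have H_N: "H N = hD"
  proof
    fix y
    have "Re (w y) > 0" using N\<rho> by (simp add: w)
    then have "w y \<notin> \<int>\<^sub>\<le>\<^sub>0" by (rule right_half_plane_notin_nonpos_Ints)
    then have "Gamma (w y) * rGamma (w y) = 1"
      by (simp add: rGamma_inverse_Gamma Gamma_eq_zero_iff)
    then have "H N y = h y * (Gamma (w y + (\<alpha> + \<gamma>)) * rGamma (w y + \<gamma>))"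
      by (simp add: H_def mult_ac)
    then show "H N y = hD y" by (simp add: hD_def w_def algebra_simps)
  qed
  \<comment> \<open>Induction downwards from \<open>k = N\<close>, dividing by \<open>w - N + k\<close> in each step.\<close>
  have int: "integrable lborel (H k)" if "k \<le> N" for k
    using that
  proof (induction rule: inc_induct)
    case base
    then show ?case using hD H_N by simp
  next
    case (step k)
    \<comment> \<open>The modulus of \<open>w - N + k\<close> is at least its real part \<open>\<delta>\<close>, which does not depend on \<open>y\<close>.\<close>
    define \<delta> where "\<delta> = Re \<rho> - real N + real k"
    have \<delta>: "\<delta> > 0" using N\<rho> by (simp add: \<delta>_def)
    have nz: "\<delta> \<le> norm (w y - of_nat N + of_nat k)" for y
      using complex_Re_le_cmod[of "w y - of_nat N + of_nat k"] by (simp add: w \<delta>_def)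
    have nz': "w y - of_nat N + of_nat k \<noteq> 0" for y
      using nz[of y] \<delta> by auto
    have eq: "H k = (\<lambda>y. H (Suc k) y / (w y - of_nat N + of_nat k))"
      using nz' by (intro ext) (simp flip: H_Suc)
    show ?case
    proof (rule Bochner_Integration.integrable_bound)
      show "integrable lborel (\<lambda>y. H (Suc k) y / of_real \<delta>)" using step by simp
      have "(\<lambda>y. w y - of_nat N + of_nat k) \<in> borel_measurable borel"
        unfolding w_def by (intro borel_measurable_continuous_onI continuous_intros)
      then show "H k \<in> borel_measurable lborel"
        using step unfolding eq by (intro borel_measurable_divide) auto
      show "AE y in lborel. norm (H k y) \<le> norm (H (Suc k) y / of_real \<delta>)"
        using nz \<delta> unfolding eq by (intro AE_I2) (simp add: norm_divide frac_le)
    qed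
  qed
  define \<Phi> where "\<Phi> = (\<lambda>k x. LINT y|lborel. H k y * of_real x powr (of_nat N - of_nat k - \<rho> + \<i> * of_real (\<mu> * y)))"
  have \<Phi>_deriv: "(\<Phi> k has_vector_derivative - \<Phi> (Suc k) x) (at x)" if k: "k < N" and x: "x > 0" for k x
  proof -
    have e: "of_nat N - of_nat k - \<rho> + \<i> * of_real (\<mu> * y) = - (w y - of_nat N + of_nat k)" for y
      by (simp add: w_def)
    have HS: "(of_nat N - of_nat k - \<rho> + \<i> * of_real (\<mu> * y)) * H k y = - H (Suc k) y" for y
      unfolding e mult_minus_left H_Suc ..
    have "integrable lborel (\<lambda>y. (of_nat N - of_nat k - \<rho> + \<i> * of_real (\<mu> * y)) * H k y)"
      unfolding HS using int[of "Suc k"] k by simp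
    from mellin_has_vector_derivative[OF x int this] k
    have "(\<Phi> k has_vector_derivative (LINT y|lborel. - H (Suc k) y * of_real x powr (of_nat N - of_nat k - \<rho> - 1 + \<i> * of_real (\<mu> * y)))) (at x)"
      unfolding HS \<Phi>_def by simp
    also have "(LINT y|lborel. - H (Suc k) y * of_real x powr (of_nat N - of_nat k - \<rho> - 1 + \<i> * of_real (\<mu> * y))) = - \<Phi> (Suc k) x"
      by (simp add: \<Phi>_def algebra_simps)
    finally show ?thesis .
  qed
  define \<alpha>' \<beta>' \<gamma>' where "\<alpha>' = - \<alpha> + of_nat N" and "\<beta>' = - 0 - (of_nat N :: complex)" and "\<gamma>' = \<alpha> + \<gamma>"
  have saigo: "set_integrable lborel {x<..} (saigo_integrand \<alpha>' \<beta>' \<gamma>' f x) \<and> saigo_int \<alpha>' \<beta>' \<gamma>' f x = \<Phi> 0 x"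
    if x: "x > 0" for x
  proof -
    define k where "k = saigo_integrand \<alpha>' \<beta>' \<gamma>' (\<lambda>t. of_real t powr (- \<rho>)) x"
    have power: "set_integrable lborel {x<..} (saigo_integrand \<alpha>' \<beta>' \<gamma>' (\<lambda>t. of_real t powr (- v)) x)"
      "(LINT t:{x<..}|lborel. saigo_integrand \<alpha>' \<beta>' \<gamma>' (\<lambda>t. of_real t powr (- v)) x t) =
         of_real x powr (of_nat N - v) * (Gamma \<alpha>' * Gamma (v - of_nat N) * Gamma (v + (\<alpha> + \<gamma>)) * rGamma v * rGamma (v + \<gamma>))"
      if v: "Re v = Re \<rho>" for v
    proof -
      have 1: "Re \<alpha>' > 0" "Re (v + \<beta>') > 0" "Re (v + \<gamma>') > 0"
        using N\<alpha> N\<rho> \<rho>(2) v by (auto simp: \<alpha>'_def \<beta>'_def \<gamma>'_def)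
      show "set_integrable lborel {x<..} (saigo_integrand \<alpha>' \<beta>' \<gamma>' (\<lambda>t. of_real t powr (- v)) x)"
        by (rule saigo_integral_powr(1)[OF 1(1) x 1(2,3)])
      have 2: "- v - \<beta>' = of_nat N - v" "v + \<beta>' = v - of_nat N" "v + \<gamma>' = v + (\<alpha> + \<gamma>)"
          "v + \<alpha>' + \<beta>' + \<gamma>' = v + \<gamma>"
        by (simp_all add: \<alpha>'_def \<beta>'_def \<gamma>'_def)
      show "(LINT t:{x<..}|lborel. saigo_integrand \<alpha>' \<beta>' \<gamma>' (\<lambda>t. of_real t powr (- v)) x t) =
         of_real x powr (of_nat N - v) * (Gamma \<alpha>' * Gamma (v - of_nat N) * Gamma (v + (\<alpha> + \<gamma>)) * rGamma v * rGamma (v + \<gamma>))"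
        using saigo_integral_powr(2)[OF 1(1) x 1(2,3)] unfolding 2 .
    qed
    have kint: "set_integrable lborel {x<..} k" unfolding k_def by (rule power) simp
    have eq: "saigo_integrand \<alpha>' \<beta>' \<gamma>' f x t = k t * (LINT y|lborel. h y * of_real t powr (\<i> * of_real (\<mu> * y)))"
      if "t \<in> {x<..}" for t
      using f[of t] that x by (simp add: k_def saigo_integrand_def mult_ac)
    have kw: "(LINT t:{x<..}|lborel. k t * of_real t powr (\<i> * of_real (\<mu> * y))) =
        of_real x powr (of_nat N - w y) * (Gamma \<alpha>' * Gamma (w y - of_nat N) * Gamma (w y + (\<alpha> + \<gamma>)) * rGamma (w y) * rGamma (w y + \<gamma>))" for y
    proof -
      have "k t * of_real t powr (\<i> * of_real (\<mu> * y)) = saigo_integrand \<alpha>' \<beta>' \<gamma>' (\<lambda>t. of_real t powr (- w y)) x t" for t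
        by (simp add: k_def saigo_integrand_def w_def powr_add[symmetric])
      then show ?thesis using power(2)[OF w[of y]] by simp
    qed
    have A: "set_integrable lborel {x<..} (saigo_integrand \<alpha>' \<beta>' \<gamma>' f x)"
      by (subst set_integrable_cong[OF refl refl eq]) (use mellin_fubini(1)[OF x kint h] in auto)
    have "(LINT t:{x<..}|lborel. saigo_integrand \<alpha>' \<beta>' \<gamma>' f x t) =
       (LINT t:{x<..}|lborel. k t * (LINT y|lborel. h y * of_real t powr (\<i> * of_real (\<mu> * y))))"
      by (rule set_lebesgue_integral_cong) (auto simp: eq)
    also have "\<dots> = (LINT y|lborel. Gamma \<alpha>' * (H 0 y * of_real x powr (of_nat N - w y)))"
      unfolding mellin_fubini(2)[OF x kint h] kw by (simp add: H_def mult_ac)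
    also have "\<dots> = Gamma \<alpha>' * (LINT y|lborel. H 0 y * of_real x powr (of_nat N - w y))"
      by (rule integral_mult_right_zero)
    also have "(LINT y|lborel. H 0 y * of_real x powr (of_nat N - w y)) = \<Phi> 0 x"
      by (simp add: \<Phi>_def w_def algebra_simps)
    finally have "(LINT t:{x<..}|lborel. saigo_integrand \<alpha>' \<beta>' \<gamma>' f x t) = Gamma \<alpha>' * \<Phi> 0 x" .
    moreover have "Gamma \<alpha>' \<noteq> 0"
      using right_half_plane_notin_nonpos_Ints[OF N\<alpha>] by (simp add: \<alpha>'_def Gamma_eq_zero_iff)
    ultimately show ?thesis using A by (simp add: saigo_int_def)
  qed
  have iter0: "saigo_deriv_iter 0 \<alpha> 0 \<gamma> f = saigo_int \<alpha>' \<beta>' \<gamma>' f"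
    by (simp add: saigo_deriv_iter_def Let_def \<alpha>'_def \<beta>'_def \<gamma>'_def N_def)
  have iterS: "saigo_deriv_iter (Suc k) \<alpha> 0 \<gamma> f = (\<lambda>x. - vector_derivative (saigo_deriv_iter k \<alpha> 0 \<gamma> f) (at x))" for k
    by (simp add: saigo_deriv_iter_def Let_def)
  \<comment> \<open>Functions on the whole line are differentiated, but the formula holds on the open half-line only.\<close>
  have transfer: "(g has_vector_derivative - \<Phi> (Suc k) x) (at x)"
    if k: "k < N" and x: "x > 0" and g: "\<And>x. x > 0 \<Longrightarrow> g x = \<Phi> k x" for g k x
    by (rule has_vector_derivative_transform_within_open[OF \<Phi>_deriv[OF k x], of "{0<..}"])
       (use x g in auto)
  have iter: "saigo_deriv_iter k \<alpha> 0 \<gamma> f x = \<Phi> k x" if "k \<le> N" "x > 0" for k x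
    using that
  proof (induction k arbitrary: x)
    case 0
    then show ?case using saigo iter0 by simp
  next
    case (Suc k)
    then have "(saigo_deriv_iter k \<alpha> 0 \<gamma> f has_vector_derivative - \<Phi> (Suc k) x) (at x)"
      by (intro transfer) auto
    then show ?case by (simp add: iterS vector_derivative_at)
  qed
  have "set_integrable lborel {y<..} (saigo_integrand (- \<alpha> + of_nat N) (- 0 - of_nat N) (\<alpha> + \<gamma>) f y) \<and>
     (\<forall>k<N. saigo_deriv_iter k \<alpha> 0 \<gamma> f differentiable (at y))" if y: "y > 0" for y
  proof (intro conjI allI impI)
    show "set_integrable lborel {y<..} (saigo_integrand (- \<alpha> + of_nat N) (- 0 - of_nat N) (\<alpha> + \<gamma>) f y)"
      using saigo[OF y] unfolding \<alpha>'_def \<beta>'_def \<gamma>'_def by blast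
    show "saigo_deriv_iter k \<alpha> 0 \<gamma> f differentiable (at y)" if "k < N" for k
      using transfer[OF that y, of "saigo_deriv_iter k \<alpha> 0 \<gamma> f"] iter that
      by (auto intro: differentiableI_vector)
  qed
  moreover have "\<forall>\<^sub>F y in nhds x. y > 0"
    using x by (intro eventually_nhds_in_open[of "{0<..}", simplified]) auto
  ultimately show "erdelyi_kober_deriv_exists \<gamma> \<alpha> f x"
    unfolding erdelyi_kober_deriv_exists_def saigo_deriv_exists_def Let_def N_def
    by (auto elim!: eventually_mono)
  have "erdelyi_kober_deriv \<gamma> \<alpha> f x = \<Phi> N x"
    using iter[of N x] x by (simp add: erdelyi_kober_deriv_def saigo_deriv_def N_def)
  also have "\<dots> = (LINT y|lborel. of_real x powr (- \<rho>) * (hD y * of_real x powr (\<i> * of_real (\<mu> * y))))"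
    using x by (simp add: \<Phi>_def H_N powr_add mult_ac)
  also have "\<dots> = of_real x powr (- \<rho>) * (LINT y|lborel. hD y * of_real x powr (\<i> * of_real (\<mu> * y)))"
    by (rule integral_mult_right_zero)
  finally show "erdelyi_kober_deriv \<gamma> \<alpha> f x =
      of_real x powr (- \<rho>) * (LINT y|lborel. hD y * of_real x powr (\<i> * of_real (\<mu> * y)))" .
qed

section \<open>The fractional derivative of the I-function\<close>

text \<open>
The weight of \<open>I[a x\<^bsup>-\<mu>\<^esup>]\<close> as a superposition of the powers \<open>x\<^bsup>i\<mu>y\<^esup>\<close>: it is the integrand of the I-function
at \<open>x = 1\<close> without the factor \<open>i\<close> of \<open>ds\<close>, and \<open>x\<close> enters only through the power.
\<close>

definition I_weight ::
  "(complex \<Rightarrow> real \<Rightarrow> real \<Rightarrow> complex \<Rightarrow> complex) \<Rightarrow> nat \<Rightarrow> nat \<Rightarrow> triple list \<Rightarrow> triple list \<Rightarrow>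
   complex \<Rightarrow> real \<Rightarrow> real \<Rightarrow> complex"
where
  "I_weight G m n as bs a \<theta> y =
     I_chi G m n as bs (\<i> * of_real y) * exp (- (\<i> * of_real y) * (of_real (ln (norm a)) + \<i> * of_real \<theta>))"

lemma I_fun_eq_mellin:
  assumes "a \<noteq> 0" "x > 0"
  shows "I_fun G m n as bs (a * of_real (x powr (- \<mu>))) \<theta> =
    1 / (2 * of_real pi) * (LINT y|lborel. I_weight G m n as bs a \<theta> y * of_real x powr (\<i> * of_real (\<mu> * y)))"
proof -
  have ln: "ln (norm (a * of_real (x powr (- \<mu>)))) = ln (norm a) - \<mu> * ln x"
    using assms by (simp add: norm_mult ln_mult ln_powr)
  have eq: "I_chi G m n as bs (\<i> * of_real y) * exp (- (\<i> * of_real y) *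
        (of_real (ln (norm (a * of_real (x powr (- \<mu>))))) + \<i> * of_real \<theta>)) * \<i> =
      \<i> * (I_weight G m n as bs a \<theta> y * of_real x powr (\<i> * of_real (\<mu> * y)))" for y
  proof -
    have "- (\<i> * of_real y) * (of_real (ln (norm (a * of_real (x powr (- \<mu>))))) + \<i> * of_real \<theta>) =
       - (\<i> * of_real y) * (of_real (ln (norm a)) + \<i> * of_real \<theta>) + \<i> * of_real (\<mu> * y) * of_real (ln x)"
      unfolding ln by (simp add: algebra_simps)
    then show ?thesis
      by (simp only: exp_add I_weight_def of_real_powr_exp[OF assms(2)] mult_ac)
  qed
  have "(LINT y|lborel. \<i> * (I_weight G m n as bs a \<theta> y * of_real x powr (\<i> * of_real (\<mu> * y)))) =
      \<i> * (LINT y|lborel. I_weight G m n as bs a \<theta> y * of_real x powr (\<i> * of_real (\<mu> * y)))"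
    by (rule integral_mult_right_zero)
  then show ?thesis
    unfolding I_fun_def Let_def eq by simp
qed

text \<open>
At a pole of the added denominator factor, dividing by the value \<open>0\<close> and multiplying by \<open>rGamma\<close> both
give \<open>0\<close>.
\<close>

lemma I_chi_insert_erdelyi_kober:
  assumes G: "gamma_power_branches G" and s: "Re s = 0" and m: "m \<le> length bs"
  shows "I_chi G m (n + 1) ((1 - \<alpha> - \<gamma> - \<rho>, \<mu>, 1) # as) (bs @ [(1 - \<gamma> - \<rho>, \<mu>, 1)]) s =
    I_chi G m n as bs s * (Gamma (\<alpha> + \<gamma> + \<rho> - of_real \<mu> * s) * rGamma (\<gamma> + \<rho> - of_real \<mu> * s))"
proof -
  have "gfac_refl G (1 - \<alpha> - \<gamma> - \<rho>, \<mu>, 1) s = Gamma (\<alpha> + \<gamma> + \<rho> - of_real \<mu> * s)"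
    "gfac_refl G (1 - \<gamma> - \<rho>, \<mu>, 1) s = Gamma (\<gamma> + \<rho> - of_real \<mu> * s)"
    using branch_exponent_one[OF G s] by (simp_all add: gfac_refl_def add.assoc)
  then show ?thesis
    using m by (simp add: I_chi_def rGamma_inverse_Gamma divide_inverse mult_ac)
qed

theorem corollary4p4:
  fixes G :: "complex \<Rightarrow> real \<Rightarrow> real \<Rightarrow> complex \<Rightarrow> complex"
    and m n :: nat and as bs :: "triple list"
    and \<alpha> \<gamma> \<rho> a :: complex and \<mu> \<theta> :: real
  assumes "gamma_power_branches G"
    and "Re \<alpha> > 0" and "a \<noteq> 0" and "is_Arg a \<theta>" and "\<mu> > 0"
    and "Re \<rho> > max (of_int (\<lfloor>Re \<alpha>\<rfloor> + 1)) (Re (- \<alpha> - \<gamma>))"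
    and "I_admissible m n as bs \<theta>"
    and "I_admissible m (n + 1) ((1 - \<alpha> - \<gamma> - \<rho>, \<mu>, 1) # as) (bs @ [(1 - \<gamma> - \<rho>, \<mu>, 1)]) \<theta>"
  defines "f \<equiv> \<lambda>t::real. of_real t powr (- \<rho>) * I_fun G m n as bs (a * of_real (t powr (- \<mu>))) \<theta>"
  shows "\<forall>x>0.
    erdelyi_kober_deriv_exists \<gamma> \<alpha> f x \<and>
    erdelyi_kober_deriv \<gamma> \<alpha> f x =
      of_real x powr (- \<rho>) *
      I_fun G m (n + 1) ((1 - \<alpha> - \<gamma> - \<rho>, \<mu>, 1) # as) (bs @ [(1 - \<gamma> - \<rho>, \<mu>, 1)])
        (a * of_real (x powr (- \<mu>))) \<theta>"
proof (intro allI impI)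
  fix x :: real assume x: "x > 0"
  define as' where "as' = (1 - \<alpha> - \<gamma> - \<rho>, \<mu>, 1) # as"
  define bs' where "bs' = bs @ [(1 - \<gamma> - \<rho>, \<mu>, 1)]"
  \<comment> \<open>The normalisation \<open>1/(2\<pi>)\<close> is \<open>1/(2\<pi>i)\<close> times the factor \<open>i\<close> of \<open>ds = i dy\<close>.\<close>
  define h where "h = (\<lambda>y. 1 / (2 * of_real pi) * I_weight G m n as bs a \<theta> y)"
  have m: "m \<le> length bs"
    using assms(7) by (simp add: I_admissible_def)
  have int: "integrable lborel h"
    unfolding h_def I_weight_def by (intro integrable_mult_right I_admissible_integrable assms)
  have hD: "h y * (Gamma (\<alpha> + \<gamma> + \<rho> - \<i> * of_real (\<mu> * y)) * rGamma (\<gamma> + \<rho> - \<i> * of_real (\<mu> * y))) =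
      1 / (2 * of_real pi) * I_weight G m (n + 1) as' bs' a \<theta> y" for y
    using I_chi_insert_erdelyi_kober[OF assms(1) _ m, where s = "\<i> * of_real y" and n = n and as = as and \<alpha> = \<alpha> and \<gamma> = \<gamma> and \<rho> = \<rho> and \<mu> = \<mu>]
    by (simp add: h_def I_weight_def as'_def bs'_def mult_ac)
  have intD: "integrable lborel (\<lambda>y. h y * (Gamma (\<alpha> + \<gamma> + \<rho> - \<i> * of_real (\<mu> * y)) * rGamma (\<gamma> + \<rho> - \<i> * of_real (\<mu> * y))))"
    unfolding hD I_weight_def as'_def bs'_def
    by (intro integrable_mult_right I_admissible_integrable assms)
  have f: "f t = of_real t powr (- \<rho>) * (LINT y|lborel. h y * of_real t powr (\<i> * of_real (\<mu> * y)))" if "t > 0" for t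
    unfolding f_def I_fun_eq_mellin[OF assms(3) that] h_def by (simp only: mult.assoc integral_mult_right_zero)
  have \<rho>: "Re \<rho> > real (saigo_order \<alpha>)" "Re (\<rho> + \<alpha> + \<gamma>) > 0"
    using assms(2,6) by (auto simp: saigo_order_def)
  note * = erdelyi_kober_mellin[OF assms(2) \<rho> int f intD x]
  have "erdelyi_kober_deriv \<gamma> \<alpha> f x = of_real x powr (- \<rho>) * I_fun G m (n + 1) as' bs' (a * of_real (x powr (- \<mu>))) \<theta>"
    by (subst *(2)) (simp_all only: hD I_fun_eq_mellin[OF assms(3) x] mult.assoc integral_mult_right_zero)
  with *(1) show "erdelyi_kober_deriv_exists \<gamma> \<alpha> f x \<and>
    erdelyi_kober_deriv \<gamma> \<alpha> f x =
      of_real x powr (- \<rho>) *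
      I_fun G m (n + 1) ((1 - \<alpha> - \<gamma> - \<rho>, \<mu>, 1) # as) (bs @ [(1 - \<gamma> - \<rho>, \<mu>, 1)])
        (a * of_real (x powr (- \<mu>))) \<theta>"
    unfolding as'_def bs'_def by blast
qed

end
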